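(* Let $E=(0,1]$. Let $(\xi_j)_{j\ge1}$ be a stationary sequence of random variables and $(u_n)_n$ a sequence of real numbers such that $\lim_{n\to\infty}nP(\xi_1>u_n)=1$. Let $N_n=\sum_{j=1}^n\delta_{j/n}1_{\{\xi_j>u_n\}}$. Let $k_n\to\infty$ be integers, $r_n=[n/k_n]$, $J_{i,n}=((i-1)r_n,ir_n]$ (viewed as a set of integers), and $$N_{i,n}=\sum_{j\in J_{i,n}}\delta_{j/n}1_{\{\xi_j>u_n\}},\qquad 1\le i\le k_n.$$ Suppose that $\lim_{n\to\infty}\max_{i\le k_n}P(N_{i,n}(B)>0)=0$ for every $B\in\mathcal B$, and that $\lim_{n\to\infty}\big|E(e^{-N_n(f)})-\prod_{i=1}^{k_n}E(e^{-N_{i,n}(f)})\big|=0$ for every $f\in C_K^+(E)$. Suppose moreover that for some $a>0$ and some probability distribution $(\pi_k)_{k\ge1}$ on the positive integers, $$k_nP\big(\max_{j\in J_{1,n}}\xi_j>u_n\big)\to a,\qquad P\Big(\sum_{j\in J_{1,n}}1_{\{\xi_j>u_n\}}=k\ \Big|\ \max_{j\in J_{1,n}}\xi_j>u_n\Big)\to\pi_k\quad\text{for all }k\ge1.$$ Let $Y_{i,n}=\max\{j/n:\ j\in J_{i,n},\ \xi_j>u_n\}$ (with $Y_{i,n}=0$ if this set is empty), let $$\nu(dy)=a\,1_{(0,1]}(y)\,dy,\qquad K(y,M)=\sum_{k\ge1}\pi_k1_M(k\delta_y),$$ and let $\lambda(M)=\int_0^\infty K(y,M)\,\nu(dy)$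 for $M\in\mathcal M_p(E)$. Then: (a) $\sum_{i=1}^{k_n}P(Y_{i,n}>x)\to\lambda(M_x)$ for every $x>0$; (b) $\sum_{i=1}^{k_n}P(Y_{i,n}>x,\ N_{i,n}\in M)\to\lambda(M\cap M_x)$ for every $x>0$ with $\lambda(M_x)>0$ and every $M\in\mathcal M_0$ such that $\lambda(\partial M\cap M_x)=0$; and, for all $x>0$ and $M\in\mathcal M_p(E)$, $\lambda(M_x)=\nu(x,\infty)$ and $\lambda(M\cap M_x)=\int_x^\infty K(y,M)\,\nu(dy)$.
   Context: $\mathcal B$ is the class of relatively compact Borel subsets of $E=(0,1]$. $M_p(E)$ is the set of Radon measures on $E$ taking values in $\mathbb Z_+$ on sets of $\mathcal B$, endowed with the topology of vague convergence ($\mu_n\to\mu$ iff $\mu_n(f)\to\mu(f)$ for all $f\in C_K^+(E)$, where $\mu(f)=\int f\,d\mu$ and $C_K^+(E)$ is the set of continuous compactly supported $f:E\to[0,\infty)$) and its Borel $\sigma$-field $\mathcal M_p(E)$. A point process on $E$ is a random element of $M_p(E)$. Notation: $o$ is the null measure; $M_0=M_p(E)\setminus\{o\}$; $\mathcal M_0=\{M\in\mathcal M_p(E): M\subset M_0\}$; for $x>0$, $M_x=\{\mu\in M_0:\mu(\{y\in E:y>x\})>0\}$. $\partial M$ is the topological boundary of $M$; $[n/k_n]$ is the integer part. *)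

theory Defs
  imports "HOL-Probability.Probability"
begin

section \<open>Point measures on \<open>(0,1]\<close>\<close>

definition E :: "real set" where
  "E = {0<..1}"

definition borelE :: "real measure" where
  "borelE = restrict_space borel E"

text \<open>Closures are taken in \<open>E\<close>, not in the real line: \<open>{0<..1}\<close> itself is not relatively compact.\<close>

definition rel_compact_borel :: "real set set" where
  "rel_compact_borel = {B \<in> sets borelE. compact (E \<inter> closure B)}"

text \<open>Only the values on \<open>E\<close> of a member of \<open>CK_plus\<close> are constrained; these are the only ones
  seen by an integral with respect to a measure on \<open>borelE\<close>.\<close>

definition CK_plus :: "(real \<Rightarrow> real) set" where
  "CK_plus = {f. continuous_on E f \<and> (\<forall>y\<in>E. 0 \<le> f y) \<and> compact (E \<inter> closure {y\<in>E. f y \<noteq> 0})}"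

text \<open>Integer values on relatively compact sets include local finiteness, i.e. the Radon property
  for Borel measures on \<open>E\<close>.\<close>

definition Mp :: "real measure set" where
  "Mp = {\<mu>. sets \<mu> = sets borelE \<and> (\<forall>B\<in>rel_compact_borel. \<exists>m::nat. emeasure \<mu> B = of_nat m)}"

text \<open>The vague topology is the coarsest topology on \<open>Mp\<close> making all maps
  \<open>\<mu> \<mapsto> \<mu>(f)\<close>, with \<open>f \<in> CK_plus\<close>, continuous; see \<open>limitin_vague_topology\<close> below.
  It is metrisable, hence determined by its convergent sequences.\<close>

definition vague_topology :: "real measure topology" where
  "vague_topology =
     topology_generated_by {{\<mu> \<in> Mp. (\<integral>y. f y \<partial>\<mu>) \<in> U} | f U. f \<in> CK_plus \<and> open U}"

definition sets_Mp :: "real measure set set" where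
  "sets_Mp = sigma_sets Mp {U. openin vague_topology U}"

definition M0 :: "real measure set" where
  "M0 = Mp - {null_measure borelE}"

definition sets_M0 :: "real measure set set" where
  "sets_M0 = {M \<in> sets_Mp. M \<subseteq> M0}"

definition M_gt :: "real \<Rightarrow> real measure set" where
  "M_gt x = {\<mu> \<in> M0. emeasure \<mu> {y\<in>E. y > x} > 0}"

text \<open>\<open>dirac_sum S z\<close> is the sum over \<open>j \<in> S\<close> of the Dirac masses at \<open>z j\<close>.\<close>

definition dirac_sum :: "nat set \<Rightarrow> (nat \<Rightarrow> real) \<Rightarrow> real measure" where
  "dirac_sum S z = measure_of E (sets borelE) (\<lambda>B. \<Sum>j\<in>S. emeasure (return borelE (z j)) B)"


section \<open>Exceedances\<close>

text \<open>Strict stationarity of \<open>\<xi> 1, \<xi> 2, \<dots>\<close>; the value \<open>\<xi> 0\<close> is never used.\<close>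

definition stationary_seq :: "'a measure \<Rightarrow> (nat \<Rightarrow> 'a \<Rightarrow> real) \<Rightarrow> bool" where
  "stationary_seq P \<xi> \<longleftrightarrow>
     (\<forall>m h. distr P (\<Pi>\<^sub>M j\<in>{1..m}. borel) (\<lambda>\<omega>. \<lambda>j\<in>{1..m}. \<xi> (j + h) \<omega>)
          = distr P (\<Pi>\<^sub>M j\<in>{1..m}. borel) (\<lambda>\<omega>. \<lambda>j\<in>{1..m}. \<xi> j \<omega>))"

definition exceed :: "(nat \<Rightarrow> 'a \<Rightarrow> real) \<Rightarrow> (nat \<Rightarrow> real) \<Rightarrow> nat \<Rightarrow> nat set \<Rightarrow> 'a \<Rightarrow> nat set" where
  "exceed \<xi> u n J \<omega> = {j\<in>J. \<xi> j \<omega> > u n}"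

definition exceed_process ::
    "(nat \<Rightarrow> 'a \<Rightarrow> real) \<Rightarrow> (nat \<Rightarrow> real) \<Rightarrow> nat \<Rightarrow> nat set \<Rightarrow> 'a \<Rightarrow> real measure" where
  "exceed_process \<xi> u n J \<omega> = dirac_sum (exceed \<xi> u n J \<omega>) (\<lambda>j. real j / real n)"

definition block :: "(nat \<Rightarrow> nat) \<Rightarrow> nat \<Rightarrow> nat \<Rightarrow> nat set" where
  "block k n i = {(i - 1) * (n div k n)<..i * (n div k n)}"

definition last_exceed ::
    "(nat \<Rightarrow> 'a \<Rightarrow> real) \<Rightarrow> (nat \<Rightarrow> real) \<Rightarrow> nat \<Rightarrow> nat set \<Rightarrow> 'a \<Rightarrow> real" where
  "last_exceed \<xi> u n J \<omega> =
     (if exceed \<xi> u n J \<omega> = {} then 0 else Max ((\<lambda>j. real j / real n) ` exceed \<xi> u n J \<omega>))"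


section \<open>The limit measure\<close>

definition nu :: "real \<Rightarrow> real measure" where
  "nu a = density lborel (\<lambda>y. ennreal (a * indicator {0<..1} y))"

text \<open>The sum over \<open>k \<ge> 1\<close> is reindexed by \<open>k = Suc m\<close>.\<close>

definition K :: "(nat \<Rightarrow> real) \<Rightarrow> real \<Rightarrow> real measure set \<Rightarrow> ennreal" where
  "K p y M = (\<Sum>m. ennreal (p (Suc m)) *
     indicator M (scale_measure (of_nat (Suc m)) (return borelE y)))"

definition lam :: "real \<Rightarrow> (nat \<Rightarrow> real) \<Rightarrow> real measure set \<Rightarrow> ennreal" where
  "lam a p M = (\<integral>\<^sup>+y. K p y M * indicator {0<..} y \<partial>nu a)"


section \<open>Sanity checks\<close>

lemma space_borelE [simp]: "space borelE = E"
  by (simp add: borelE_def space_restrict_space)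

lemma sets_dirac_sum [simp]: "sets (dirac_sum S z) = sets borelE"
proof -
  have "sigma_sets E (sets borelE) = sets borelE"
    using sets.sigma_sets_eq[of borelE] by simp
  moreover have "sets borelE \<subseteq> Pow E"
    using sets.space_closed[of borelE] by simp
  ultimately show ?thesis
    by (simp add: dirac_sum_def)
qed

lemma emeasure_dirac_sum:
  assumes "B \<in> sets borelE"
  shows "emeasure (dirac_sum S z) B = (\<Sum>j\<in>S. indicator B (z j))"
proof -
  have "emeasure (dirac_sum S z) B = (\<Sum>j\<in>S. emeasure (return borelE (z j)) B)"
    unfolding dirac_sum_def
  proof (rule emeasure_measure_of_sigma)
    show "sigma_algebra E (sets borelE)"
      using sets.sigma_algebra_axioms[of borelE] by simp
    show "positive (sets borelE) (\<lambda>B. \<Sum>j\<in>S. emeasure (return borelE (z j)) B)"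
      by (simp add: positive_def)
    show "countably_additive (sets borelE) (\<lambda>B. \<Sum>j\<in>S. emeasure (return borelE (z j)) B)"
    proof (rule countably_additiveI)
      fix A :: "nat \<Rightarrow> real set"
      assume A: "range A \<subseteq> sets borelE" "disjoint_family A"
      have "(\<Sum>i. emeasure (return borelE (z j)) (A i))
          = emeasure (return borelE (z j)) (\<Union>i. A i)" for j
        using A by (intro suminf_emeasure) auto
      then show "(\<Sum>i. \<Sum>j\<in>S. emeasure (return borelE (z j)) (A i))
          = (\<Sum>j\<in>S. emeasure (return borelE (z j)) (\<Union>i. A i))"
        by (subst suminf_sum) (auto simp del: emeasure_return)
    qed
  qed (fact assms)
  then show ?thesis
    using assms by simp
qed

lemma dirac_sum_in_Mp:
  assumes "finite S"
  shows "dirac_sum S z \<in> Mp"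
proof -
  have "emeasure (dirac_sum S z) B = of_nat (card {j\<in>S. z j \<in> B})" if "B \<in> sets borelE" for B
  proof -
    have "(\<Sum>j\<in>S. indicator B (z j) :: ennreal) = (\<Sum>j\<in>{j\<in>S. z j \<in> B}. 1)"
      using assms by (simp add: indicator_def sum.If_cases Int_def)
    then show ?thesis
      using that by (simp add: emeasure_dirac_sum)
  qed
  then show ?thesis
    by (auto simp: Mp_def rel_compact_borel_def)
qed

lemma topspace_vague_topology [simp]: "topspace vague_topology = Mp"
proof -
  have "(\<lambda>_. 0) \<in> CK_plus"
    by (simp add: CK_plus_def)
  then have "Mp \<in> {{\<mu> \<in> Mp. (\<integral>y. f y \<partial>\<mu>) \<in> U} | f U. f \<in> CK_plus \<and> open U}"
    by (auto intro!: exI[of _ "\<lambda>_. 0"] exI[of _ UNIV])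
  then show ?thesis
    unfolding vague_topology_def topology_generated_by_topspace by blast
qed

lemma limitin_vague_topology:
  assumes "\<And>n. X n \<in> Mp"
  shows "limitin vague_topology X \<mu> sequentially \<longleftrightarrow>
    \<mu> \<in> Mp \<and> (\<forall>f\<in>CK_plus. (\<lambda>n. \<integral>y. f y \<partial>X n) \<longlonglongrightarrow> (\<integral>y. f y \<partial>\<mu>))"
    (is "?L \<longleftrightarrow> ?R")
proof
  assume L: ?L
  have "(\<lambda>n. \<integral>y. f y \<partial>X n) \<longlonglongrightarrow> (\<integral>y. f y \<partial>\<mu>)" if f: "f \<in> CK_plus" for f
  proof (rule topological_tendstoI)
    fix U :: "real set"
    assume U: "open U" "(\<integral>y. f y \<partial>\<mu>) \<in> U"
    have "openin vague_topology {\<mu> \<in> Mp. (\<integral>y. f y \<partial>\<mu>) \<in> U}"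
      unfolding vague_topology_def using f U by (intro topology_generated_by_Basis) auto
    then have "\<forall>\<^sub>F n in sequentially. X n \<in> {\<mu> \<in> Mp. (\<integral>y. f y \<partial>\<mu>) \<in> U}"
      using L U by (auto simp: limitin_def)
    then show "\<forall>\<^sub>F n in sequentially. (\<integral>y. f y \<partial>X n) \<in> U"
      by eventually_elim simp
  qed
  then show ?R
    using L by (auto simp: limitin_def)
next
  assume R: ?R
  let ?S = "{{\<mu> \<in> Mp. (\<integral>y. f y \<partial>\<mu>) \<in> U} | f U. f \<in> CK_plus \<and> open U}"
  have "\<mu> \<in> V \<longrightarrow> (\<forall>\<^sub>F n in sequentially. X n \<in> V)" if "generate_topology_on ?S V" for V
    using that
  proof induction
    case (Int a b)
    then show ?case
      by (auto intro: eventually_conj)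
  next
    case (UN W)
    show ?case
    proof
      assume "\<mu> \<in> \<Union>W"
      then obtain V where V: "V \<in> W" "\<mu> \<in> V" by blast
      then have "\<forall>\<^sub>F n in sequentially. X n \<in> V"
        using UN.IH by blast
      then show "\<forall>\<^sub>F n in sequentially. X n \<in> \<Union>W"
        by eventually_elim (use V in blast)
    qed
  next
    case (Basis V)
    then obtain f U where V: "V = {\<mu> \<in> Mp. (\<integral>y. f y \<partial>\<mu>) \<in> U}" "f \<in> CK_plus" "open U"
      by blast
    then show ?case
      using R assms by (auto dest: topological_tendstoD)
  qed auto
  then show ?L
    using R by (auto simp: limitin_def vague_topology_def[symmetric] simp flip: openin_topology_generated_by_iff)
qed

end

theory Submission
  imports Defs
begin

text \<open>By stationarity all blocks have the same law of exceedance counts, so each sum over the blocks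
  is the integral over \<open>(0,1]\<close> of a step function that is constant on the block intervals. The block
  containing \<open>y\<close> shrinks to \<open>y\<close>, so given \<open>m\<close> exceedances its point process is vaguely close to
  \<open>m \<delta>\<^sub>y\<close>; hence the step function converges at every \<open>y\<close> for which no \<open>m \<delta>\<^sub>y\<close> with \<open>\<pi>\<^sub>m > 0\<close> lies on
  the boundary of the given set, and dominated convergence applies. That the blocks asymptotically
  exhaust \<open>(0,1]\<close>, i.e. \<open>k\<^sub>n r\<^sub>n / n \<rightarrow> 1\<close>, is not assumed: it is forced by the factorization of the
  Laplace functionals. Part (a) is the convergence in (b) for the set of all point measures.\<close>

section \<open>Finite sums of Dirac masses and the limit kernel\<close>

text \<open>The cluster-size limits are given for each size separately, so large sizes are not
  controlled uniformly when passing to the limit under the sum over sizes. Conservation of mass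
  takes the place of such control: lower bounds for \<open>M\<close> and for its complement, which
  has the same boundary, add up to \<open>a\<close>, the limit of \<open>k n * q n\<close>, and this
  leaves no room for either side to exceed its bound. Exhaustion of the unit interval matters twice:
  a fixed y < 1 must eventually lie in some block, and the step function carries the factor n / r_n
  where the hypotheses control the factor k_n. Random measures are handled as functions of a finite
  exceedance set, so every event in question concerns a discrete random variable.\<close>

abbreviation atom :: "nat \<Rightarrow> real \<Rightarrow> real measure" where
  "atom m y \<equiv> scale_measure (of_nat m) (return borelE y)"

text \<open>The definition by \<open>measure_of\<close> gives only values on sets; as an image of
  counting measure, the same object has integrals that reduce to finite sums.\<close>

lemma dirac_sum_eq_distr:
  assumes "finite S" "z ` S \<subseteq> E"
  shows "dirac_sum S z = distr (count_space S) borelE z"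
proof (rule measure_eqI)
  fix B assume "B \<in> sets (dirac_sum S z)"
  then have B: "B \<in> sets borelE" by simp
  have z: "z \<in> measurable (count_space S) borelE" using assms(2) by auto
  have "(\<Sum>j\<in>S. indicator B (z j) :: ennreal) = of_nat (card (z -` B \<inter> S))"
    using assms(1) by (simp add: indicator_def sum.If_cases Int_commute vimage_def Collect_conj_eq)
  also have "\<dots> = emeasure (distr (count_space S) borelE z) B"
    using assms(1) B by (simp add: emeasure_distr[OF z B] emeasure_count_space_finite)
  finally show "emeasure (dirac_sum S z) B = emeasure (distr (count_space S) borelE z) B"
    using B by (simp add: emeasure_dirac_sum)
qed simp

lemma integral_dirac_sum:
  fixes f :: "real \<Rightarrow> real"
  assumes "finite S" "z ` S \<subseteq> E" "continuous_on E f"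
  shows "(\<integral>y. f y \<partial>dirac_sum S z) = (\<Sum>j\<in>S. f (z j))"
proof -
  have "f \<in> borel_measurable borelE"
    unfolding borelE_def using assms(3) by (rule borel_measurable_continuous_on_restrict)
  moreover have "z \<in> measurable (count_space S) borelE" using assms(2) by auto
  ultimately show ?thesis
    using assms(1) by (simp add: dirac_sum_eq_distr[OF assms(1,2)] integral_distr
        lebesgue_integral_count_space_finite)
qed

lemma atom_eq_dirac_sum: "atom m y = dirac_sum {..<m} (\<lambda>_. y)"
  by (rule measure_eqI) (auto simp: emeasure_dirac_sum)

lemma atom_in_Mp: "atom m y \<in> Mp"
  by (simp add: atom_eq_dirac_sum dirac_sum_in_Mp)

text \<open>With the number of points fixed, continuity of a test function at y controls its whole
  sum. Vague convergence is available through sequences, so a failure for every radius 1/(n+1) is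
  turned into a convergent sequence that stays outside \<open>V\<close>. The radius is the same for
  all configurations of m points, which later gives uniformity in \<omega>.\<close>

lemma dirac_sum_vague_nhd:
  assumes V: "openin vague_topology V" and y: "y \<in> E" and yV: "atom m y \<in> V"
  shows "\<exists>\<eta>>0. \<forall>(S::nat set) z. finite S \<longrightarrow> card S = m \<longrightarrow> z ` S \<subseteq> E \<longrightarrow>
    (\<forall>j\<in>S. \<bar>z j - y\<bar> < \<eta>) \<longrightarrow> dirac_sum S z \<in> V"
proof (rule ccontr)
  assume no: "\<not> ?thesis"
  have "\<exists>(S::nat set) z. finite S \<and> card S = m \<and> z ` S \<subseteq> E \<and>
      (\<forall>j\<in>S. \<bar>z j - y\<bar> < inverse (real (Suc n))) \<and> dirac_sum S z \<notin> V" for n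
  proof -
    have "inverse (real (Suc n)) > 0" by simp
    then show ?thesis using no by blast
  qed
  then obtain S :: "nat \<Rightarrow> nat set" and z where Sz: "\<And>n. finite (S n)" "\<And>n. card (S n) = m"
      "\<And>n. z n ` S n \<subseteq> E" "\<And>n j. j \<in> S n \<Longrightarrow> \<bar>z n j - y\<bar> < inverse (real (Suc n))"
      "\<And>n. dirac_sum (S n) (z n) \<notin> V"
    by metis
  have "limitin vague_topology (\<lambda>n. dirac_sum (S n) (z n)) (atom m y) sequentially"
  proof (subst limitin_vague_topology)
    show "atom m y \<in> Mp \<and> (\<forall>f\<in>CK_plus. (\<lambda>n. \<integral>y. f y \<partial>dirac_sum (S n) (z n)) \<longlonglongrightarrow> (\<integral>y. f y \<partial>atom m y))"
    proof (intro conjI ballI)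
      fix f assume "f \<in> CK_plus"
      then have cf: "continuous_on E f" by (simp add: CK_plus_def)
      have eq: "(\<integral>y. f y \<partial>atom m y) = real m * f y"
        using y cf by (subst atom_eq_dirac_sum, subst integral_dirac_sum) auto
      show "(\<lambda>n. \<integral>y. f y \<partial>dirac_sum (S n) (z n)) \<longlonglongrightarrow> (\<integral>y. f y \<partial>atom m y)"
        unfolding eq integral_dirac_sum[OF Sz(1,3) cf]
      proof (rule LIMSEQ_I)
        fix e :: real assume e: "e > 0"
        \<comment> \<open>Then m errors of this size add up to strictly less than e, also for m =
          0.\<close>
        then have "e / (real m + 1) > 0" by simp
        then obtain d where d: "d > 0"
            "\<And>y'. y' \<in> E \<Longrightarrow> dist y' y < d \<Longrightarrow> dist (f y') (f y) < e / (real m + 1)"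
          using cf y unfolding continuous_on_iff by metis
        obtain n0 where n0: "inverse (real (Suc n0)) < d"
          using reals_Archimedean[OF d(1)] by blast
        have "norm ((\<Sum>j\<in>S n. f (z n j)) - real m * f y) < e" if n: "n \<ge> n0" for n
        proof -
          have "inverse (real (Suc n)) \<le> inverse (real (Suc n0))"
            using n by (intro le_imp_inverse_le) auto
          then have "\<bar>f (z n j) - f y\<bar> \<le> e / (real m + 1)" if "j \<in> S n" for j
          proof -
            have "dist (z n j) y < d"
              using Sz(4)[OF that] n0 \<open>inverse (real (Suc n)) \<le> inverse (real (Suc n0))\<close>
              unfolding dist_real_def by linarith
            then have "dist (f (z n j)) (f y) < e / (real m + 1)"
              using Sz(3)[of n] that by (intro d(2)) auto
            then show ?thesis by (simp add: dist_real_def)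
          qed
          then have "(\<Sum>j\<in>S n. \<bar>f (z n j) - f y\<bar>) \<le> real (card (S n)) * (e / (real m + 1))"
            by (rule sum_bounded_above)
          moreover have "\<bar>(\<Sum>j\<in>S n. f (z n j)) - real m * f y\<bar> \<le> (\<Sum>j\<in>S n. \<bar>f (z n j) - f y\<bar>)"
            using sum_abs[of "\<lambda>j. f (z n j) - f y" "S n"] Sz(2)[of n] by (simp add: sum_subtractf)
          moreover have "real (card (S n)) * (e / (real m + 1)) < e"
            using e Sz(2)[of n] by (simp add: field_simps)
          ultimately show ?thesis by simp
        qed
        then show "\<exists>no. \<forall>n\<ge>no. norm ((\<Sum>j\<in>S n. f (z n j)) - real m * f y) < e" by blast
      qed
    qed (rule atom_in_Mp)
  qed (simp add: dirac_sum_in_Mp Sz(1))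
  then have "\<forall>\<^sub>F n in sequentially. dirac_sum (S n) (z n) \<in> V"
    using V yV by (auto simp: limitin_def)
  then show False using Sz(5) by (simp add: eventually_sequentially)
qed

section \<open>Measurability of the kernel and its truncation at x\<close>

lemma atom_outside: "y \<notin> E \<Longrightarrow> atom m y = null_measure borelE"
  using sets.sets_into_space[of _ borelE] by (intro measure_eqI) (auto simp: indicator_def)

text \<open>On \<open>E\<close> the map taking y to m Dirac masses at y is continuous by
  \<open>dirac_sum_vague_nhd\<close>, so preimages of open sets are relatively open and the rest is
  induction over the \<sigma>-algebra. Off \<open>E\<close> the map is constantly the null measure,
  which adds either nothing or the whole complement of \<open>E\<close>.\<close>

lemma borel_atom_vimage:
  assumes "M \<in> sets_Mp"
  shows "{y. atom m y \<in> M} \<in> sets borel"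
proof -
  have E: "E \<in> sets borel" by (simp add: E_def)
  have "{y \<in> E. atom m y \<in> M} \<in> sets borel"
    using assms unfolding sets_Mp_def
  proof induction
    case (Basic V)
    then have V: "openin vague_topology V" by simp
    have "openin (top_of_set E) {y \<in> E. atom m y \<in> V}"
      unfolding openin_euclidean_subtopology_iff
    proof (intro conjI ballI)
      fix y assume "y \<in> {y \<in> E. atom m y \<in> V}"
      then obtain \<eta> where \<eta>: "\<eta> > 0" "\<And>(S::nat set) z. finite S \<Longrightarrow> card S = m \<Longrightarrow> z ` S \<subseteq> E \<Longrightarrow>
          (\<And>j. j \<in> S \<Longrightarrow> \<bar>z j - y\<bar> < \<eta>) \<Longrightarrow> dirac_sum S z \<in> V"
        using dirac_sum_vague_nhd[OF V, of y m] by auto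
      have "atom m y' \<in> V" if "y' \<in> E" "dist y' y < \<eta>" for y'
        unfolding atom_eq_dirac_sum using that by (intro \<eta>(2)) (auto simp: dist_real_def)
      then show "\<exists>e>0. \<forall>x'\<in>E. dist x' y < e \<longrightarrow> x' \<in> {y \<in> E. atom m y \<in> V}"
        using \<eta>(1) by auto
    qed auto
    then show ?case
      using E by (auto simp: openin_open)
  next
    case (Compl A)
    have "{y \<in> E. atom m y \<in> Mp - A} = E - {y \<in> E. atom m y \<in> A}"
      using atom_in_Mp by auto
    then show ?case using Compl E by auto
  next
    case (Union A)
    have "{y \<in> E. atom m y \<in> \<Union>(range A)} = (\<Union>i. {y \<in> E. atom m y \<in> A i})" by auto
    then show ?case using Union by auto
  qed simp
  moreover have "{y. atom m y \<in> M} = {y \<in> E. atom m y \<in> M} \<union> (if null_measure borelE \<in> M then - E else {})"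
  proof (rule set_eqI)
    show "y \<in> {y. atom m y \<in> M} \<longleftrightarrow>
        y \<in> {y \<in> E. atom m y \<in> M} \<union> (if null_measure borelE \<in> M then - E else {})" for y
      using atom_outside[of y m] by (cases "y \<in> E") auto
  qed
  ultimately show ?thesis using E by auto
qed

lemma K_eq: "K p y M = (\<Sum>m. ennreal (p (Suc m)) * indicator {y. atom (Suc m) y \<in> M} y)"
  unfolding K_def by (simp add: indicator_def)

lemma borel_measurable_K [measurable]:
  assumes "M \<in> sets_Mp"
  shows "(\<lambda>y. K p y M) \<in> borel_measurable borel"
proof -
  note borel_atom_vimage[OF assms, measurable]
  show ?thesis unfolding K_eq by measurable
qed

lemma atom_in_M_gt_iff:
  assumes "y \<in> E"
  shows "atom (Suc m) y \<in> M_gt x \<longleftrightarrow> y > x"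
proof -
  have B: "{y\<in>E. y > x} \<in> sets borelE"
    by (auto simp: borelE_def sets_restrict_space_iff E_def)
  have "atom (Suc m) y \<noteq> null_measure borelE"
  proof
    assume "atom (Suc m) y = null_measure borelE"
    then have "emeasure (atom (Suc m) y) E = 0" by simp
    then show False using assms sets.top[of borelE] by (simp add: indicator_def)
  qed
  moreover have "emeasure (atom (Suc m) y) {y\<in>E. y > x} > 0 \<longleftrightarrow> y > x"
    using B assms by (simp add: indicator_def add_pos_nonneg)
  ultimately show ?thesis
    using atom_in_Mp[of "Suc m" y] unfolding M_gt_def M0_def by auto
qed

text \<open>All the measures charged by the kernel at y are positive multiples of one Dirac mass at
  y, so membership in \<open>M_gt x\<close> depends on y alone and factors out.\<close>

lemma K_Int_M_gt:
  assumes "y \<in> E"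
  shows "K p y (M \<inter> M_gt x) = K p y M * indicator {x<..} y"
  using assms unfolding K_def by (auto simp: indicator_def atom_in_M_gt_iff simp del: of_nat_Suc)

lemma AE_nu: "AE y in nu a. y \<in> E"
  unfolding nu_def by (subst AE_density) (auto simp: E_def indicator_def)

lemma lam_Int_M_gt:
  assumes "x > 0"
  shows "lam a p (M \<inter> M_gt x) = (\<integral>\<^sup>+y. K p y M * indicator {x<..} y \<partial>nu a)"
  unfolding lam_def
proof (rule nn_integral_cong_AE)
  show "AE y in nu a. K p y (M \<inter> M_gt x) * indicator {0<..} y = K p y M * indicator {x<..} y"
    using AE_nu
  proof eventually_elim
    case (elim y)
    then show ?case using assms by (auto simp: K_Int_M_gt indicator_def E_def)
  qed
qed

lemma K_Mp:
  assumes "\<And>m. m \<ge> 1 \<Longrightarrow> p m \<ge> 0" "(\<lambda>m. p (Suc m)) sums 1"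
  shows "K p y Mp = 1"
proof -
  have "(\<lambda>m. ennreal (p (Suc m))) sums ennreal 1"
    using assms by (intro sums_ennreal[THEN iffD2]) auto
  then show ?thesis
    unfolding K_def using atom_in_Mp by (simp add: sums_iff del: of_nat_Suc)
qed

lemma M_gt_subset_Mp: "M_gt x \<subseteq> Mp"
  by (auto simp: M_gt_def M0_def)

lemma Mp_in_sets_Mp: "Mp \<in> sets_Mp"
  unfolding sets_Mp_def by (rule sigma_sets_top)

lemma lam_M_gt:
  assumes "\<And>m. m \<ge> 1 \<Longrightarrow> p m \<ge> 0" "(\<lambda>m. p (Suc m)) sums 1" "x > 0"
  shows "lam a p (M_gt x) = emeasure (nu a) {x<..}"
proof -
  have "lam a p (M_gt x) = lam a p (Mp \<inter> M_gt x)"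
    using M_gt_subset_Mp by (simp add: Int_absorb1)
  also have "\<dots> = (\<integral>\<^sup>+y. indicator {x<..} y \<partial>nu a)"
    using assms by (simp add: lam_Int_M_gt K_Mp)
  finally show ?thesis by (simp add: nu_def)
qed

lemma nn_integral_nu:
  assumes "f \<in> borel_measurable borel" "a \<ge> 0"
  shows "(\<integral>\<^sup>+y. f y \<partial>nu a) = (\<integral>\<^sup>+y. ennreal a * f y * indicator E y \<partial>lborel)"
  unfolding nu_def using assms
  by (subst nn_integral_density) (auto intro!: nn_integral_cong simp: E_def indicator_def)

section \<open>The boundary hypothesis in pointwise form\<close>

lemma frontier_in_sets_Mp: "vague_topology frontier_of M \<in> sets_Mp"
proof -
  have "openin vague_topology (Mp - vague_topology frontier_of M)"
    using closedin_frontier_of[of vague_topology M] by (simp add: closedin_def)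
  then have "Mp - (Mp - vague_topology frontier_of M) \<in> sets_Mp"
    unfolding sets_Mp_def by (intro sigma_sets.Compl sigma_sets.Basic) simp
  moreover have "vague_topology frontier_of M \<subseteq> Mp"
    using frontier_of_subset_topspace[of vague_topology M] by simp
  ultimately show ?thesis by (simp add: double_diff)
qed

text \<open>A vanishing integral of a nonnegative function makes the integrand vanish almost
  everywhere, and then each term of the kernel series vanishes; positivity of \<open>a\<close> and
  of \<open>p (Suc m)\<close> leaves only the indicator to be 0.\<close>

lemma AE_atom_notin_frontier:
  assumes "x > 0" "a > 0" "lam a p ((vague_topology frontier_of M) \<inter> M_gt x) = 0"
  shows "AE y in lborel. y \<in> E \<longrightarrow> y > x \<longrightarrow>
    (\<forall>m. p (Suc m) > 0 \<longrightarrow> atom (Suc m) y \<notin> vague_topology frontier_of M)"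
proof -
  let ?F = "vague_topology frontier_of M"
  have F: "?F \<in> sets_Mp" by (rule frontier_in_sets_Mp)
  note borel_measurable_K[OF F, measurable]
  have [measurable]: "E \<in> sets borel" by (simp add: E_def)
  have "(\<integral>\<^sup>+y. ennreal a * (K p y ?F * indicator {x<..} y) * indicator E y \<partial>lborel) = 0"
    using assms by (subst nn_integral_nu[symmetric]) (auto simp: lam_Int_M_gt)
  then have "AE y in lborel. ennreal a * (K p y ?F * indicator {x<..} y) * indicator E y = 0"
    by (subst (asm) nn_integral_0_iff_AE) auto
  then show ?thesis
  proof eventually_elim
    case (elim y)
    show ?case
    proof (intro impI allI notI)
      fix m assume y: "y \<in> E" "y > x" and p: "p (Suc m) > 0" and "atom (Suc m) y \<in> ?F"
      have "K p y ?F = 0" using elim y assms(2) by (auto simp: indicator_def)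
      then have "ennreal (p (Suc m)) * indicator ?F (atom (Suc m) y) = 0"
        unfolding K_def by (subst (asm) suminf_eq_zero_iff) auto
      then show False using p \<open>atom (Suc m) y \<in> ?F\<close> by (simp add: indicator_def)
    qed
  qed
qed

section \<open>Stationary exceedances and Laplace functionals\<close>

text \<open>There are only finitely many values, so it suffices to check singletons. With the
  discrete target, any predicate of the exceedance set is an event, including membership of the
  associated point measure in an arbitrary set \<open>M\<close>.\<close>

lemma measurable_exceedance_set:
  fixes f :: "nat \<Rightarrow> 'b \<Rightarrow> real"
  assumes "finite J" "\<And>j. j \<in> J \<Longrightarrow> f j \<in> borel_measurable M"
  shows "(\<lambda>\<omega>. {j\<in>J. f j \<omega> > c}) \<in> measurable M (count_space UNIV)"
proof -
  have "(\<lambda>\<omega>. {j\<in>J. f j \<omega> > c}) \<in> measurable M (count_space (Pow J))"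
  proof (subst measurable_count_space_eq2)
    show "(\<lambda>\<omega>. {j\<in>J. f j \<omega> > c}) \<in> space M \<rightarrow> Pow J \<and>
      (\<forall>S\<in>Pow J. (\<lambda>\<omega>. {j\<in>J. f j \<omega> > c}) -` {S} \<inter> space M \<in> sets M)"
    proof (intro conjI ballI)
      fix S assume "S \<in> Pow J"
      then have "(\<lambda>\<omega>. {j\<in>J. f j \<omega> > c}) -` {S} \<inter> space M =
          {\<omega>\<in>space M. \<forall>j\<in>J. (f j \<omega> > c) = (j \<in> S)}" by auto
      also have "\<dots> \<in> sets M"
      proof (rule sets.sets_Collect_finite_All[OF _ assms(1)])
        fix j assume "j \<in> J"
        note assms(2)[OF this, measurable]
        show "{\<omega> \<in> space M. (f j \<omega> > c) = (j \<in> S)} \<in> sets M" by measurable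
      qed
      finally show "(\<lambda>\<omega>. {j\<in>J. f j \<omega> > c}) -` {S} \<inter> space M \<in> sets M" .
    qed auto
  qed (simp add: assms)
  then show ?thesis
    using measurable_compose[of _ M "count_space (Pow J)" "\<lambda>S. S" "count_space UNIV"] by simp
qed

text \<open>A ramp that detects points beyond c. Since 1 belongs to \<open>E\<close>, compact
  support only requires staying away from 0, and the ramp need not come down again.\<close>

definition tent :: "real \<Rightarrow> real \<Rightarrow> real" where
  "tent c y = max 0 (y - c)"

lemma tent_nonneg: "0 \<le> tent c y"
  by (simp add: tent_def)

lemma tent_in_CK_plus:
  assumes "c > 0"
  shows "tent c \<in> CK_plus"
proof -
  let ?C = "closure {y \<in> E. tent c y \<noteq> 0}"
  have "?C \<subseteq> {c..1}"
    by (rule closure_minimal) (auto simp: E_def tent_def)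
  moreover have "{c..1} \<subseteq> E" using assms by (auto simp: E_def)
  ultimately have "E \<inter> ?C = ?C" by blast
  moreover have "compact ?C"
    using closed_Int_compact[OF closed_closure compact_Icc, of "{y \<in> E. tent c y \<noteq> 0}" c 1]
    by (simp add: Int_absorb2[OF \<open>?C \<subseteq> {c..1}\<close>])
  moreover have "continuous_on E (tent c)" unfolding tent_def by (intro continuous_intros)
  ultimately show ?thesis by (simp add: CK_plus_def tent_nonneg)
qed

lemma finite_block [simp]: "finite (block k n i)"
  by (simp add: block_def)

lemma block_subset:
  assumes "i \<le> k n"
  shows "block k n i \<subseteq> {1..n}"
proof -
  have "i * (n div k n) \<le> n"
    using mult_le_mono1[OF assms, of "n div k n"] times_div_less_eq_dividend[of "k n" n]
    by (rule order_trans)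
  then show ?thesis by (auto simp: block_def)
qed

lemma exceed_subset: "exceed \<xi> u n J \<omega> \<subseteq> J"
  by (auto simp: exceed_def)

lemma finite_exceed: "finite J \<Longrightarrow> finite (exceed \<xi> u n J \<omega>)"
  by (rule finite_subset[OF exceed_subset])

lemma exceed_process_in_Mp: "finite J \<Longrightarrow> exceed_process \<xi> u n J \<omega> \<in> Mp"
  by (simp add: exceed_process_def dirac_sum_in_Mp finite_exceed)

lemma integral_exceed_process:
  fixes f :: "real \<Rightarrow> real"
  assumes "J \<subseteq> {1..n}" "continuous_on E f"
  shows "(\<integral>y. f y \<partial>exceed_process \<xi> u n J \<omega>) = (\<Sum>j\<in>exceed \<xi> u n J \<omega>. f (real j / real n))"
proof -
  have "finite J" using assms(1) finite_subset by blast
  moreover have "(\<lambda>j. real j / real n) ` exceed \<xi> u n J \<omega> \<subseteq> E"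
  proof (rule image_subsetI)
    fix j assume "j \<in> exceed \<xi> u n J \<omega>"
    then have "1 \<le> j" "j \<le> n" using assms(1) exceed_subset[of \<xi> u n J \<omega>] by auto
    then show "real j / real n \<in> E" by (simp add: E_def)
  qed
  ultimately show ?thesis
    unfolding exceed_process_def by (rule integral_dirac_sum[OF finite_exceed _ assms(2)])
qed

locale exceedances = prob_space P for P :: "'a measure" +
  fixes \<xi> :: "nat \<Rightarrow> 'a \<Rightarrow> real" and u :: "nat \<Rightarrow> real"
  assumes measurable_\<xi>: "\<And>j. j \<ge> 1 \<Longrightarrow> \<xi> j \<in> borel_measurable P"
    and stationary: "stationary_seq P \<xi>"
begin

lemma measurable_exceed:
  assumes "finite J" "0 \<notin> J"
  shows "exceed \<xi> u n J \<in> measurable P (count_space UNIV)"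
  using assms unfolding exceed_def
  by (intro measurable_exceedance_set measurable_\<xi>) (auto intro: Suc_leI gr0I)

lemma sets_exceed:
  assumes "finite J" "0 \<notin> J"
  shows "{\<omega> \<in> space P. Q (exceed \<xi> u n J \<omega>)} \<in> events"
  using measurable_sets[OF measurable_exceed[OF assms], of "{S. Q S}"]
  by (simp add: vimage_def Int_def conj_commute)

text \<open>The count is a function of r consecutive variables, so both sides are the mass of one
  set \<open>A\<close> under two joint laws that stationarity identifies.\<close>

lemma prob_exceed_shift:
  "\<P>(\<omega> in P. Q (card (exceed \<xi> u n {h<..h + r} \<omega>))) = \<P>(\<omega> in P. Q (card (exceed \<xi> u n {0<..r} \<omega>)))"
proof -
  let ?M = "\<Pi>\<^sub>M j\<in>{1..r}. (borel :: real measure)"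
  define A where "A = {z \<in> space ?M. Q (card {j\<in>{1..r}. z j > u n})}"
  have "(\<lambda>z. {j\<in>{1..r}. z j > u n}) \<in> measurable ?M (count_space UNIV)"
    by (rule measurable_exceedance_set) auto
  from measurable_sets[OF this, of "{S. Q (card S)}"] have A: "A \<in> sets ?M"
    by (simp add: A_def vimage_def Int_def conj_commute)
  \<comment> \<open>Proved for every shift, because the right-hand side of the claim is the case of
    shift 0.\<close>
  have *: "measure (distr P ?M (\<lambda>\<omega>. \<lambda>j\<in>{1..r}. \<xi> (j + h) \<omega>)) A =
      \<P>(\<omega> in P. Q (card (exceed \<xi> u n {h<..h + r} \<omega>)))" for h
  proof -
    have m: "(\<lambda>\<omega>. \<lambda>j\<in>{1..r}. \<xi> (j + h) \<omega>) \<in> measurable P ?M"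
      by (intro measurable_restrict measurable_\<xi>) auto
    have "card {j\<in>{1..r}. \<xi> (j + h) \<omega> > u n} = card (exceed \<xi> u n {h<..h + r} \<omega>)" for \<omega>
    proof (rule bij_betw_same_card)
      show "bij_betw (\<lambda>j. j + h) {j\<in>{1..r}. \<xi> (j + h) \<omega> > u n} (exceed \<xi> u n {h<..h + r} \<omega>)"
        unfolding exceed_def
        by (rule bij_betw_byWitness[where f' = "\<lambda>j. j - h"]) auto
    qed
    moreover have "{j\<in>{1..r}. (\<lambda>j\<in>{1..r}. \<xi> (j + h) \<omega>) j > u n} = {j\<in>{1..r}. \<xi> (j + h) \<omega> > u n}" for \<omega>
      by auto
    moreover have "(\<lambda>j\<in>{1..r}. \<xi> (j + h) \<omega>) \<in> space ?M" for \<omega>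
      by (auto simp: space_PiM)
    ultimately show ?thesis
      by (subst measure_distr[OF m A]) (auto simp: A_def intro!: arg_cong[where f = "measure P"])
  qed
  have "distr P ?M (\<lambda>\<omega>. \<lambda>j\<in>{1..r}. \<xi> (j + h) \<omega>) = distr P ?M (\<lambda>\<omega>. \<lambda>j\<in>{1..r}. \<xi> (j + 0) \<omega>)"
    using stationary by (simp add: stationary_seq_def)
  then show ?thesis
    using *[of h] *[of 0] by simp
qed

lemma prob_exceed_nonempty_shift:
  "\<P>(\<omega> in P. exceed \<xi> u n {h<..h + r} \<omega> \<noteq> {}) = \<P>(\<omega> in P. exceed \<xi> u n {0<..r} \<omega> \<noteq> {})"
  using prob_exceed_shift[of "\<lambda>c. c \<noteq> 0" n h r] by (simp add: finite_exceed)

lemma prob_exceed_block: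
  assumes "i \<ge> 1"
  shows "\<P>(\<omega> in P. Q (card (exceed \<xi> u n (block k n i) \<omega>))) = \<P>(\<omega> in P. Q (card (exceed \<xi> u n (block k n 1) \<omega>)))"
proof -
  have "block k n i = {(i - 1) * (n div k n)<..(i - 1) * (n div k n) + n div k n}"
    using assms by (cases i) (auto simp: block_def)
  then show ?thesis
    using prob_exceed_shift[of Q n "(i - 1) * (n div k n)" "n div k n"] by (simp add: block_def)
qed

lemma prob_exceed_block_nonempty:
  assumes "i \<ge> 1"
  shows "\<P>(\<omega> in P. exceed \<xi> u n (block k n i) \<omega> \<noteq> {}) = \<P>(\<omega> in P. exceed \<xi> u n (block k n 1) \<omega> \<noteq> {})"
  using prob_exceed_block[OF assms, of "\<lambda>c. c \<noteq> 0"] by (simp add: finite_exceed)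

section \<open>Bounds for Laplace functionals of ramps\<close>

lemma measurable_laplace:
  assumes "J \<subseteq> {1..n}"
  shows "(\<lambda>\<omega>. exp (- (\<integral>y. tent c y \<partial>exceed_process \<xi> u n J \<omega>))) \<in> borel_measurable P"
  unfolding exceed_process_def 
  by (rule measurable_compose[OF measurable_exceed])
    (use assms finite_subset in auto)

lemma integral_tent:
  assumes "J \<subseteq> {1..n}"
  shows "(\<integral>y. tent c y \<partial>exceed_process \<xi> u n J \<omega>) = (\<Sum>j\<in>exceed \<xi> u n J \<omega>. tent c (real j / real n))"
  using assms by (rule integral_exceed_process) (auto simp: tent_def intro!: continuous_intros)

lemma integral_tent_nonneg: "0 \<le> (\<integral>y. tent c y \<partial>\<mu>)"
  by (simp add: tent_nonneg)

lemma integrable_laplace: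
  assumes "J \<subseteq> {1..n}"
  shows "integrable P (\<lambda>\<omega>. exp (- (\<integral>y. tent c y \<partial>exceed_process \<xi> u n J \<omega>)))"
  using measurable_laplace[OF assms]
  by (rule integrable_const_bound[where B = 1, rotated]) (auto simp: integral_tent_nonneg)

text \<open>A single exceedance in \<open>J'\<close> contributes at least d to the integral of the
  ramp, so the integrand is at most exp(-d) on that event and at most 1 elsewhere.\<close>

lemma laplace_upper:
  assumes J: "J \<subseteq> {1..n}" "J' \<subseteq> J" and d: "\<And>j. j \<in> J' \<Longrightarrow> real j / real n \<ge> c + d"
  shows "(\<integral>\<omega>. exp (- (\<integral>y. tent c y \<partial>exceed_process \<xi> u n J \<omega>)) \<partial>P)
    \<le> 1 - (1 - exp (- d)) * \<P>(\<omega> in P. exceed \<xi> u n J' \<omega> \<noteq> {})"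
proof -
  let ?A = "{\<omega> \<in> space P. exceed \<xi> u n J' \<omega> \<noteq> {}}"
  have A: "?A \<in> events" 
    by (rule sets_exceed) (use J finite_subset[of J' "{1..n}"] in auto)
  have iA: "integrable P (indicator ?A :: 'a \<Rightarrow> real)"
    by (rule integrable_real_indicator[OF A]) (simp add: emeasure_eq_measure)
  have "(\<integral>\<omega>. exp (- (\<integral>y. tent c y \<partial>exceed_process \<xi> u n J \<omega>)) \<partial>P)
      \<le> (\<integral>\<omega>. 1 - (1 - exp (- d)) * indicator ?A \<omega> \<partial>P)"
  proof (rule integral_mono)
    show "integrable P (\<lambda>\<omega>. 1 - (1 - exp (- d)) * indicator ?A \<omega>)"
      using iA by (intro Bochner_Integration.integrable_diff integrable_mult_right) auto
    fix \<omega> assume \<omega>: "\<omega> \<in> space P"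
    show "exp (- (\<integral>y. tent c y \<partial>exceed_process \<xi> u n J \<omega>)) \<le> 1 - (1 - exp (- d)) * indicator ?A \<omega>"
    proof (cases "exceed \<xi> u n J' \<omega> = {}")
      case True
      then show ?thesis by (simp add: integral_tent_nonneg)
    next
      case False
      then obtain j where j: "j \<in> exceed \<xi> u n J' \<omega>" by blast
      then have "j \<in> exceed \<xi> u n J \<omega>" "j \<in> J'" using J by (auto simp: exceed_def)
      then have "tent c (real j / real n) \<le> (\<Sum>j\<in>exceed \<xi> u n J \<omega>. tent c (real j / real n))"
        using J by (intro member_le_sum finite_exceed) (auto simp: tent_nonneg intro: finite_subset)
      moreover have "d \<le> tent c (real j / real n)"
        using d[OF \<open>j \<in> J'\<close>] by (simp add: tent_def)
      ultimately show ?thesis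
        using \<omega> False integral_tent[OF J(1)] by simp
    qed
  qed (rule integrable_laplace[OF J(1)])
  also have "\<dots> = 1 - (1 - exp (- d)) * prob ?A"
    using A iA by (subst Bochner_Integration.integral_diff) (auto simp: prob_space intro!: integrable_mult_right)
  finally show ?thesis .
qed

lemma laplace_lower:
  assumes J: "J \<subseteq> {1..n}"
  shows "1 - \<P>(\<omega> in P. exceed \<xi> u n J \<omega> \<noteq> {})
    \<le> (\<integral>\<omega>. exp (- (\<integral>y. tent c y \<partial>exceed_process \<xi> u n J \<omega>)) \<partial>P)"
proof -
  let ?A = "{\<omega> \<in> space P. exceed \<xi> u n J \<omega> \<noteq> {}}"
  have A: "?A \<in> events" 
    by (rule sets_exceed) (use J finite_subset[of J "{1..n}"] in auto)
  have iA: "integrable P (indicator ?A :: 'a \<Rightarrow> real)"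
    by (rule integrable_real_indicator[OF A]) (simp add: emeasure_eq_measure)
  have "1 - prob ?A = (\<integral>\<omega>. 1 - indicator ?A \<omega> \<partial>P)"
    using A iA by (subst Bochner_Integration.integral_diff) (auto simp: prob_space intro!: integrable_mult_right)
  also have "\<dots> \<le> (\<integral>\<omega>. exp (- (\<integral>y. tent c y \<partial>exceed_process \<xi> u n J \<omega>)) \<partial>P)"
  proof (rule integral_mono)
    show "integrable P (\<lambda>\<omega>. 1 - indicator ?A \<omega> :: real)"
      using iA by (intro Bochner_Integration.integrable_diff) auto
    show "1 - indicator ?A \<omega> \<le> exp (- (\<integral>y. tent c y \<partial>exceed_process \<xi> u n J \<omega>))" if "\<omega> \<in> space P" for \<omega>
      using that integral_tent[OF J] by (auto simp: indicator_def)
  qed (rule integrable_laplace[OF J])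
  finally show ?thesis .
qed

lemma laplace_trivial:
  assumes J: "J \<subseteq> {1..n}" and "\<And>j. j \<in> J \<Longrightarrow> real j / real n \<le> c"
  shows "(\<integral>\<omega>. exp (- (\<integral>y. tent c y \<partial>exceed_process \<xi> u n J \<omega>)) \<partial>P) = 1"
proof -
  have "(\<Sum>j\<in>exceed \<xi> u n J \<omega>. tent c (real j / real n)) = 0" for \<omega>
    using assms exceed_subset[of \<xi> u n J \<omega>] by (intro sum.neutral) (force simp: tent_def)
  then show ?thesis by (simp add: integral_tent[OF J] prob_space)
qed

text \<open>Union bound over \<open>T\<close> adjacent stretches of length m, which are equally
  likely to contain an exceedance.\<close>

lemma prob_exceed_cover:
  "\<P>(\<omega> in P. exceed \<xi> u n {0<..T * m} \<omega> \<noteq> {}) \<le> real T * \<P>(\<omega> in P. exceed \<xi> u n {0<..m} \<omega> \<noteq> {})"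
proof (induction T)
  case 0
  then show ?case by (simp add: exceed_def)
next
  case (Suc T)
  let ?A = "\<lambda>J. {\<omega> \<in> space P. exceed \<xi> u n J \<omega> \<noteq> {}}"
  have "{0<..Suc T * m} = {0<..T * m} \<union> {T * m<..T * m + m}" by auto
  then have "?A {0<..Suc T * m} = ?A {0<..T * m} \<union> ?A {T * m<..T * m + m}"
    by (auto simp: exceed_def)
  then have "prob (?A {0<..Suc T * m}) \<le> prob (?A {0<..T * m}) + prob (?A {T * m<..T * m + m})"
    by (simp only:) (intro measure_Un_le sets_exceed, auto)
  then show ?case
    using Suc prob_exceed_nonempty_shift[of n "T * m" m] by (simp add: algebra_simps)
qed

end

section \<open>The blocks exhaust the unit interval\<close>

locale exceedance_clusters = exceedances P \<xi> u for P :: "'a measure" and \<xi> u +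
  fixes k :: "nat \<Rightarrow> nat" and a :: real and p :: "nat \<Rightarrow> real"
  assumes k_at_top: "filterlim k at_top sequentially"
    and laplace_factorization: "\<And>f. f \<in> CK_plus \<Longrightarrow>
      (\<lambda>n. \<bar>(\<integral>\<omega>. exp (- (\<integral>y. f y \<partial>exceed_process \<xi> u n {1..n} \<omega>)) \<partial>P)
         - (\<Prod>i\<in>{1..k n}. \<integral>\<omega>. exp (- (\<integral>y. f y \<partial>exceed_process \<xi> u n (block k n i) \<omega>)) \<partial>P)\<bar>) \<longlonglongrightarrow> 0"
    and a_pos: "a > 0"
    and p_nonneg: "\<And>m. m \<ge> 1 \<Longrightarrow> p m \<ge> 0" and p_sums: "(\<lambda>m. p (Suc m)) sums 1"
    and block_max_lim: "(\<lambda>n. real (k n) * \<P>(\<omega> in P. (MAX j\<in>block k n 1. \<xi> j \<omega>) > u n)) \<longlonglongrightarrow> a"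
    and cluster_size_lim: "\<And>m. m \<ge> 1 \<Longrightarrow>
      (\<lambda>n. \<P>(\<omega> in P. (\<Sum>j\<in>block k n 1. if \<xi> j \<omega> > u n then 1 else 0) = m
               \<bar> (MAX j\<in>block k n 1. \<xi> j \<omega>) > u n)) \<longlonglongrightarrow> p m"
begin

text \<open>By stationarity this is the common value for all blocks, not just the first.\<close>

definition q :: "nat \<Rightarrow> real" where
  "q n = \<P>(\<omega> in P. exceed \<xi> u n (block k n 1) \<omega> \<noteq> {})"

lemma q_nonneg: "0 \<le> q n"
  by (simp add: q_def)

lemma eventually_k_ge: "\<forall>\<^sub>F n in sequentially. k n \<ge> c"
  using k_at_top by (auto simp: filterlim_at_top)

text \<open>For an empty block the maximum is a constant, so that \<^term>\<open>k n\<close> times its exceedance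
  probability is \<open>0\<close> or \<^term>\<open>k n\<close> and cannot tend to a positive number.\<close>

lemma eventually_block_length: "\<forall>\<^sub>F n in sequentially. n div k n \<ge> 1"
proof -
  let ?v = "\<lambda>n. real (k n) * \<P>(\<omega> in P. (MAX j\<in>block k n 1. \<xi> j \<omega>) > u n)"
  have "\<forall>\<^sub>F n in sequentially. ?v n > 0"
    using order_tendstoD(1)[OF block_max_lim a_pos] .
  moreover have "\<forall>\<^sub>F n in sequentially. ?v n < a + 1"
    using order_tendstoD(2)[OF block_max_lim, of "a + 1"] by simp
  moreover have "\<forall>\<^sub>F n in sequentially. k n \<ge> nat \<lceil>a + 1\<rceil>"
    by (rule eventually_k_ge)
  ultimately show ?thesis
  proof eventually_elim
    case (elim n)
    show ?case
    proof (rule ccontr)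
      assume "\<not> n div k n \<ge> 1"
      then have "block k n 1 = {}" by (simp add: block_def)
      then have v: "?v n = real (k n) * \<P>(\<omega> in P. Max {} > u n)" by simp
      show False
      proof (cases "Max {} > u n")
        case True
        then show False using elim(2,3) unfolding v by (simp add: prob_space) linarith
      next
        case False
        then show False using elim(1) unfolding v by simp
      qed
    qed
  qed
qed

lemma block_max_gt_iff:
  assumes "n div k n \<ge> 1"
  shows "(MAX j\<in>block k n 1. \<xi> j \<omega>) > u n \<longleftrightarrow> exceed \<xi> u n (block k n 1) \<omega> \<noteq> {}"
proof -
  have "block k n 1 \<noteq> {}" using assms by (simp add: block_def)
  then show ?thesis by (subst Max_gr_iff) (auto simp: exceed_def)
qed

lemma k_q_lim: "(\<lambda>n. real (k n) * q n) \<longlonglongrightarrow> a"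
proof (rule Lim_transform_eventually[OF block_max_lim])
  show "\<forall>\<^sub>F n in sequentially. real (k n) * \<P>(\<omega> in P. (MAX j\<in>block k n 1. \<xi> j \<omega>) > u n) = real (k n) * q n"
    using eventually_block_length by eventually_elim (simp only: block_max_gt_iff q_def)
qed

text \<open>Multiplying by \<open>k n * q n\<close> undoes the conditioning: for m at least 1,
  having m exceedances already implies the conditioning event, whose probability is eventually
  nonzero.\<close>

lemma cluster_size_prob_lim:
  assumes "m \<ge> 1"
  shows "(\<lambda>n. real (k n) * \<P>(\<omega> in P. card (exceed \<xi> u n (block k n 1) \<omega>) = m)) \<longlonglongrightarrow> a * p m"
proof (rule Lim_transform_eventually[OF tendsto_mult[OF k_q_lim cluster_size_lim[OF assms]]])
  have "\<forall>\<^sub>F n in sequentially. real (k n) * q n > 0"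
    using order_tendstoD(1)[OF k_q_lim a_pos] .
  with eventually_block_length
  show "\<forall>\<^sub>F n in sequentially. real (k n) * q n *
      \<P>(\<omega> in P. (\<Sum>j\<in>block k n 1. if \<xi> j \<omega> > u n then 1 else 0) = m
               \<bar> (MAX j\<in>block k n 1. \<xi> j \<omega>) > u n)
      = real (k n) * \<P>(\<omega> in P. card (exceed \<xi> u n (block k n 1) \<omega>) = m)"
  proof eventually_elim
    case (elim n)
    have *: "(\<Sum>j\<in>block k n 1. if \<xi> j \<omega> > u n then 1 else 0) = card (exceed \<xi> u n (block k n 1) \<omega>)" for \<omega>
      by (simp add: exceed_def sum.If_cases Int_def)
    have "{\<omega> \<in> space P. card (exceed \<xi> u n (block k n 1) \<omega>) = m \<and> exceed \<xi> u n (block k n 1) \<omega> \<noteq> {}}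
        = {\<omega> \<in> space P. card (exceed \<xi> u n (block k n 1) \<omega>) = m}"
      using assms by auto
    moreover have "q n \<noteq> 0" using elim(2) by auto
    ultimately show ?case
      unfolding cond_prob_def block_max_gt_iff[OF elim(1)] * by (simp add: q_def)
  qed
qed

text \<open>The remainder of n modulo \<open>k n\<close> is below \<open>k n\<close>, hence below
  the total length of nonempty blocks. This crude form of exhaustion locates the later blocks before
  the sharp one is known, and afterwards supplies a dominating function.\<close>

lemma le_2_k_block_length:
  assumes "n div k n \<ge> 1"
  shows "n \<le> 2 * k n * (n div k n)"
proof -
  have "k n > 0" using assms by (auto intro: gr0I)
  have "n mod k n \<le> k n * (n div k n)"
    using mod_less_divisor[OF \<open>k n > 0\<close>, of n] mult_le_mono2[OF assms, of "k n"] by linarith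
  then show ?thesis
    using mult_div_mod_eq[of "k n" n] by linarith
qed

lemma laplace_block_le_1:
  assumes "i \<le> k n"
  shows "(\<integral>\<omega>. exp (- (\<integral>y. tent c y \<partial>exceed_process \<xi> u n (block k n i) \<omega>)) \<partial>P) \<le> 1"
  using laplace_upper[OF block_subset[where k = k and n = n and i = i, OF assms] empty_subsetI, of c 0] by simp

text \<open>For an index in \<open>?I\<close> the preceding blocks already fill half of the total
  block length, hence a quarter of n, so the block lies beyond 1/4 = 1/8 + 1/8 and the ramp is at
  least 1/8 on it. Such a factor is at most 1 - t q, hence at most exp(-t q), and the others are at
  most 1.\<close>

lemma laplace_block_prod_le:
  assumes "n div k n \<ge> 1" "k n \<ge> 4"
  shows "(\<Prod>i\<in>{1..k n}. \<integral>\<omega>. exp (- (\<integral>y. tent (1/8) y \<partial>exceed_process \<xi> u n (block k n i) \<omega>)) \<partial>P)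
    \<le> exp (- ((1 - exp (- (1/8))) * (real (k n) * q n) / 4))"
proof -
  let ?t = "1 - exp (- (1/8::real))"
  let ?L = "\<lambda>i. \<integral>\<omega>. exp (- (\<integral>y. tent (1/8) y \<partial>exceed_process \<xi> u n (block k n i) \<omega>)) \<partial>P"
  let ?I = "{k n div 2 + 2..k n}"
  have t: "?t \<ge> 0" by simp
  have "?L i \<le> (if i \<in> ?I then exp (- (?t * q n)) else 1)" if i: "i \<in> {1..k n}" for i
  proof (cases "i \<in> ?I")
    case True
    have "real j / real n \<ge> 1/8 + 1/8" if j: "j \<in> block k n i" for j
    proof -
      have "k n \<le> 2 * (i - 1)" using True by auto
      then have "2 * k n * (n div k n) \<le> 4 * ((i - 1) * (n div k n))"
        using mult_le_mono1[of "k n" "2 * (i - 1)" "2 * (n div k n)"] by (simp add: algebra_simps)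
      then have "n \<le> 4 * j"
      proof -
        have "(i - 1) * (n div k n) < j" using j by (simp add: block_def)
        then show ?thesis
          using le_2_k_block_length[OF assms(1)] \<open>2 * k n * (n div k n) \<le> 4 * ((i - 1) * (n div k n))\<close>
          by linarith
      qed
      moreover have "n > 0" using assms(1) by (auto intro: gr0I)
      ultimately show ?thesis by (simp add: field_simps)
    qed
    then have "?L i \<le> 1 - ?t * \<P>(\<omega> in P. exceed \<xi> u n (block k n i) \<omega> \<noteq> {})"
      using i by (intro laplace_upper block_subset) auto
    also have "\<dots> = 1 - ?t * q n"
      using i prob_exceed_block_nonempty[of i n k] by (simp add: q_def)
    also have "\<dots> \<le> exp (- (?t * q n))"
      using exp_ge_add_one_self[of "- (?t * q n)"] by simp
    finally show ?thesis using True by simp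
  next
    case False
    then show ?thesis using laplace_block_le_1[of i n "1/8"] i by auto
  qed
  then have "(\<Prod>i\<in>{1..k n}. ?L i) \<le> (\<Prod>i\<in>{1..k n}. if i \<in> ?I then exp (- (?t * q n)) else 1)"
    by (intro prod_mono) auto
  also have "\<dots> = exp (- (?t * q n)) ^ card ?I"
  proof -
    have "{1..k n} \<inter> {i. i \<in> ?I} = ?I" by auto
    then show ?thesis by (subst prod.If_cases) auto
  qed
  also have "\<dots> = exp (- (?t * q n * real (card ?I)))"
    by (simp add: exp_of_nat_mult[symmetric] algebra_simps)
  also have "\<dots> \<le> exp (- (?t * (real (k n) * q n) / 4))"
  proof -
    \<comment> \<open>The cardinality is k - k div 2 - 1, which is at least k/4 as soon as k is at
      least 4.\<close>
    have "real (card ?I) \<ge> real (k n) / 4"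
      using assms(2) by simp
    then have "?t * q n * (real (k n) / 4) \<le> ?t * q n * real (card ?I)"
      using t q_nonneg[of n] by (intro mult_left_mono) auto
    moreover have "?t * (real (k n) * q n) / 4 = ?t * q n * (real (k n) / 4)" by simp
    ultimately show ?thesis by (simp only: exp_le_cancel_iff neg_le_iff_le)
  qed
  finally show ?thesis .
qed

text \<open>If the blocks did not reach beyond \<^term>\<open>1 - \<delta>\<close>, then testing the factorization with
  \<^term>\<open>tent (1 - \<delta>)\<close> would show that there is asymptotically no exceedance in the last stretch,
  hence by stationarity none at all; this contradicts the factorization for \<^term>\<open>tent (1/8)\<close>.\<close>

lemma eventually_blocks_reach:
  assumes \<delta>: "0 < \<delta>" "\<delta> < 1"
  shows "\<forall>\<^sub>F n in sequentially. real (k n * (n div k n)) / real n > 1 - \<delta>"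
proof -
  define A where "A c n = (\<integral>\<omega>. exp (- (\<integral>y. tent c y \<partial>exceed_process \<xi> u n {1..n} \<omega>)) \<partial>P)" for c n
  define L where "L c n i = (\<integral>\<omega>. exp (- (\<integral>y. tent c y \<partial>exceed_process \<xi> u n (block k n i) \<omega>)) \<partial>P)" for c n i
  define d where "d c n = \<bar>A c n - (\<Prod>i\<in>{1..k n}. L c n i)\<bar>" for c n
  have d: "(\<lambda>n. d c n) \<longlonglongrightarrow> 0" if "c > 0" for c
    unfolding d_def A_def L_def using laplace_factorization[OF tent_in_CK_plus[OF that]] .
  define t :: real where "t = 1 - exp (- (1/8))"
  define w where "w = 1 - exp (- (\<delta>/2))"
  have w: "w > 0" using \<delta> by (simp add: w_def)
  have t: "t > 0" by (simp add: t_def)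
  \<comment> \<open>Below, m is at least a quarter of n\<delta>, so \<open>T\<close> stretches of
    length m cover all indices up to n.\<close>
  define T where "T = nat \<lceil>4 / \<delta>\<rceil>"
  \<comment> \<open>Chosen so that blocks stopping short of 1 - \<delta> force \<open>Z n\<close> to
    be at least 1. The terms are the union bound for any exceedance at all, the factorization error
    for the ramp at 1/8, and the bound on the product over blocks; the first two vanish in the
    limit.\<close>
  define Z where "Z n = real T * (d (1 - \<delta>) n / w) + d (1/8) n + exp (- (t * (real (k n) * q n) / 4))" for n
  have "Z \<longlonglongrightarrow> real T * (0 / w) + 0 + exp (- (t * a / 4))"
    unfolding Z_def using w \<delta> by (intro tendsto_intros d k_q_lim) auto
  moreover have "exp (- (t * a / 4)) < 1" using t a_pos by simp
  ultimately have "\<forall>\<^sub>F n in sequentially. Z n < 1"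
    using order_tendstoD(2)[of Z "exp (- (t * a / 4))"] by simp
  moreover have "\<forall>\<^sub>F n in sequentially. n \<ge> nat \<lceil>4 / \<delta>\<rceil>"
    by (rule eventually_ge_at_top)
  moreover have "\<forall>\<^sub>F n in sequentially. k n \<ge> 4" by (rule eventually_k_ge)
  ultimately show ?thesis using eventually_block_length
  proof eventually_elim
    case (elim n)
    have "4 / \<delta> \<le> real n" using elim(2) by linarith
    \<comment> \<open>This makes n\<delta>/2 - 1 at least n\<delta>/4, which absorbs the rounding in
      the choice of m.\<close>
    then have n\<delta>: "4 \<le> real n * \<delta>" using \<delta> by (simp add: field_simps)
    have n: "n > 0" using elim(4) by (auto intro: gr0I)
    show ?case
    proof (rule ccontr)
      assume "\<not> ?thesis"
      then have R: "real (k n * (n div k n)) / real n \<le> 1 - \<delta>" by simp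
      \<comment> \<open>Half of the uncovered stretch: the last m indices sit beyond 1 - \<delta>/2,
        where the ramp starting at 1 - \<delta> is at least \<delta>/2.\<close>
      define m where "m = nat \<lfloor>real n * \<delta> / 2\<rfloor>"
      define s where "s = \<P>(\<omega> in P. exceed \<xi> u n {0<..m} \<omega> \<noteq> {})"
      have m: "real m \<le> real n * \<delta> / 2" "real m \<ge> real n * \<delta> / 4"
        using n\<delta> unfolding m_def by linarith+
      moreover have "real n * \<delta> \<le> real n * 1" using \<delta> by (intro mult_left_mono) auto
      ultimately have mn: "m \<le> n" by linarith
      have "L (1 - \<delta>) n i = 1" if i: "i \<in> {1..k n}" for i
        unfolding L_def
      proof (rule laplace_trivial)
        show "block k n i \<subseteq> {1..n}" using i by (intro block_subset) auto
        fix j assume "j \<in> block k n i"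
        then have "j \<le> i * (n div k n)" by (simp add: block_def)
        also have "\<dots> \<le> k n * (n div k n)" using i by (intro mult_le_mono1) auto
        finally have "j \<le> k n * (n div k n)" .
        then have "real j / real n \<le> real (k n * (n div k n)) / real n"
          by (intro divide_right_mono) (simp_all only: of_nat_le_iff of_nat_0_le_iff)
        then show "real j / real n \<le> 1 - \<delta>" using R by linarith
      qed
      then have "(\<Prod>i\<in>{1..k n}. L (1 - \<delta>) n i) = 1" by simp
      moreover have "A (1 - \<delta>) n \<le> 1 - w * s"
      proof -
        have "A (1 - \<delta>) n \<le> 1 - w * \<P>(\<omega> in P. exceed \<xi> u n {n - m<..n - m + m} \<omega> \<noteq> {})"
          unfolding A_def w_def
        proof (rule laplace_upper)
          show "{n - m<..n - m + m} \<subseteq> {1..n}" using mn by auto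
          fix j assume "j \<in> {n - m<..n - m + m}"
          then have "real n - real m \<le> real j" by auto
          then have "real n * (1 - \<delta>/2) \<le> real j" using m(1) by (simp add: algebra_simps)
          then show "1 - \<delta> + \<delta>/2 \<le> real j / real n" using n by (simp add: field_simps)
        qed simp
        then show ?thesis using prob_exceed_nonempty_shift[of n "n - m" m] by (simp only: s_def)
      qed
      ultimately have "w * s \<le> d (1 - \<delta>) n" by (simp add: d_def)
      then have s: "s \<le> d (1 - \<delta>) n / w" using w by (simp add: field_simps)
      have "n \<le> T * m"
      proof -
        have "real n = (4 / \<delta>) * (real n * \<delta> / 4)" using \<delta> by simp
        also have "\<dots> \<le> real T * real m"
        proof (rule mult_mono)
          show "4 / \<delta> \<le> real T" unfolding T_def by (rule real_nat_ceiling_ge)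
        qed (use \<delta> m(2) in auto)
        finally show ?thesis by (simp flip: of_nat_mult)
      qed
      then have "{1..n} \<subseteq> {0<..T * m}" by auto
      then have "{\<omega> \<in> space P. exceed \<xi> u n {1..n} \<omega> \<noteq> {}} \<subseteq> {\<omega> \<in> space P. exceed \<xi> u n {0<..T * m} \<omega> \<noteq> {}}"
        unfolding exceed_def by blast
      then have "\<P>(\<omega> in P. exceed \<xi> u n {1..n} \<omega> \<noteq> {}) \<le> \<P>(\<omega> in P. exceed \<xi> u n {0<..T * m} \<omega> \<noteq> {})"
        by (intro finite_measure_mono sets_exceed) auto
      also have "\<dots> \<le> real T * s" unfolding s_def by (rule prob_exceed_cover)
      also have "\<dots> \<le> real T * (d (1 - \<delta>) n / w)" using s by (intro mult_left_mono) auto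
      finally have "1 - real T * (d (1 - \<delta>) n / w) \<le> A (1/8) n"
        using laplace_lower[of "{1..n}" n "1/8"] by (simp add: A_def)
      also have "\<dots> \<le> d (1/8) n + (\<Prod>i\<in>{1..k n}. L (1/8) n i)"
        by (simp add: d_def)
      also have "(\<Prod>i\<in>{1..k n}. L (1/8) n i) \<le> exp (- (t * (real (k n) * q n) / 4))"
        unfolding L_def t_def using elim by (intro laplace_block_prod_le) auto
      finally have "1 \<le> Z n" by (simp add: Z_def)
      then show False using elim(1) by simp
    qed
  qed
qed

lemma blocks_length_lim: "(\<lambda>n. real (k n * (n div k n)) / real n) \<longlonglongrightarrow> 1"
proof (rule order_tendstoI)
  fix b :: real assume "b < 1"
  \<comment> \<open>The cap 1/2 keeps the margin below 1 when b is not positive.\<close>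
  then have "\<forall>\<^sub>F n in sequentially. real (k n * (n div k n)) / real n > 1 - min (1 - b) (1/2)"
    by (intro eventually_blocks_reach) auto
  then show "\<forall>\<^sub>F n in sequentially. b < real (k n * (n div k n)) / real n"
  proof eventually_elim
    case (elim n)
    have "b \<le> 1 - min (1 - b) (1/2)" by simp
    then show ?case using elim by (rule le_less_trans)
  qed
next
  fix b :: real assume "1 < b"
  have "real (k n * (n div k n)) / real n \<le> 1" for n
    using times_div_less_eq_dividend[of "k n" n]
    by (cases "n = 0") (simp_all add: divide_le_eq flip: of_nat_mult)
  then show "\<forall>\<^sub>F n in sequentially. real (k n * (n div k n)) / real n < b"
    using \<open>1 < b\<close> by (intro always_eventually allI) (rule le_less_trans)
qed

end

section \<open>The block containing a given point\<close>

text \<open>Finite partial sums bound the lower limits of \<open>W\<close> and \<open>W'\<close>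
  from below by \<open>B\<close> and \<open>B'\<close>, as in Fatou's lemma. Since the totals
  converge to exactly \<open>B + B'\<close>, an excess in \<open>W\<close> would have to be a
  deficit in \<open>W'\<close>.\<close>

lemma tendsto_of_minorants:
  fixes t t' :: "nat \<Rightarrow> nat \<Rightarrow> real"
  assumes t: "\<And>m. (\<lambda>n. t n m) \<longlonglongrightarrow> l m" and t': "\<And>m. (\<lambda>n. t' n m) \<longlonglongrightarrow> l' m"
    and W: "\<And>n L. (\<Sum>m<L. t n m) \<le> W n" and W': "\<And>n L. (\<Sum>m<L. t' n m) \<le> W' n"
    and l: "l sums B" and l': "l' sums B'"
    and sum: "(\<lambda>n. W n + W' n) \<longlonglongrightarrow> B + B'"
  shows "W \<longlonglongrightarrow> B"
proof -
  have lower: "\<forall>\<^sub>F n in sequentially. b < W n"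
    if "\<And>m. (\<lambda>n. t n m) \<longlonglongrightarrow> l m" "\<And>n L. (\<Sum>m<L. t n m) \<le> W n" "l sums B" "b < B"
    for t :: "nat \<Rightarrow> nat \<Rightarrow> real" and l W B b
  proof -
    have "\<forall>\<^sub>F L in sequentially. b < (\<Sum>m<L. l m)"
      using that(3,4) unfolding sums_def by (rule order_tendstoD)
    then obtain L where L: "b < (\<Sum>m<L. l m)"
      by (auto simp: eventually_sequentially)
    have "(\<lambda>n. \<Sum>m<L. t n m) \<longlonglongrightarrow> (\<Sum>m<L. l m)" by (intro tendsto_sum that(1))
    then have "\<forall>\<^sub>F n in sequentially. b < (\<Sum>m<L. t n m)" using L by (rule order_tendstoD)
    then show ?thesis by eventually_elim (use that(2) less_le_trans in blast)
  qed
  show ?thesis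
  proof (rule order_tendstoI)
    fix b assume "b < B"
    then show "\<forall>\<^sub>F n in sequentially. b < W n" by (rule lower[OF t W l])
  next
    fix b assume "B < b"
    then have "\<forall>\<^sub>F n in sequentially. B' - (b - B) / 2 < W' n" by (intro lower[OF t' W' l']) simp
    moreover have "\<forall>\<^sub>F n in sequentially. W n + W' n < B + B' + (b - B) / 2"
      using \<open>B < b\<close> by (intro order_tendstoD(2)[OF sum]) simp
    ultimately show "\<forall>\<^sub>F n in sequentially. W n < b"
      by eventually_elim (simp add: field_simps)
  qed
qed

text \<open>Positivity of x matters: the default value 0 for no exceedance must not count as lying
  beyond x.\<close>

lemma last_exceed_gt_iff:
  assumes "finite J" "x > 0"
  shows "last_exceed \<xi> u n J \<omega> > x \<longleftrightarrow> (\<exists>j\<in>exceed \<xi> u n J \<omega>. real j / real n > x)"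
  using assms by (auto simp: last_exceed_def finite_exceed Max_gr_iff)

lemma zero_notin_block: "0 \<notin> block k n i"
  by (simp add: block_def)

lemma block_width_tendsto_0:
  assumes "filterlim k at_top sequentially"
  shows "(\<lambda>n. real (n div k n) / real n) \<longlonglongrightarrow> 0"
proof (rule tendsto_sandwich[where f = "\<lambda>_. 0" and h = "\<lambda>n. inverse (real (k n))"])
  have "filterlim (\<lambda>n. real (k n)) at_top sequentially"
    using filterlim_compose[OF filterlim_real_sequentially assms] .
  then show "(\<lambda>n. inverse (real (k n))) \<longlonglongrightarrow> 0"
    by (rule tendsto_inverse_0_at_top)
  show "\<forall>\<^sub>F n in sequentially. real (n div k n) / real n \<le> inverse (real (k n))"
    using filterlim_at_top_dense[THEN iffD1, OF \<open>filterlim (\<lambda>n. real (k n)) at_top sequentially\<close>, rule_format, of 0]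
      eventually_gt_at_top[of 0]
  proof eventually_elim
    case (elim n)
    have "real (k n) * real (n div k n) \<le> real n"
      using times_div_less_eq_dividend[of "k n" n] by (simp flip: of_nat_mult)
    then show ?case using elim by (simp add: field_simps)
  qed
qed auto

context exceedance_clusters
begin

text \<open>The kernel \<open>K\<close> as a real number, so that limits of probabilities and
  complements can be handled by real arithmetic.\<close>

definition G :: "real measure set \<Rightarrow> real \<Rightarrow> real" where
  "G M y = (\<Sum>m. p (Suc m) * indicator M (atom (Suc m) y))"

lemma G_sums: "(\<lambda>m. p (Suc m) * indicator M (atom (Suc m) y)) sums G M y"
proof -
  have "summable (\<lambda>m. p (Suc m) * indicator M (atom (Suc m) y))"
    using p_nonneg by (intro summable_comparison_test'[OF sums_summable[OF p_sums]])
      (auto simp: indicator_def)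
  then show ?thesis by (simp add: G_def summable_sums)
qed

lemma G_nonneg: "0 \<le> G M y"
  unfolding G_def using sums_summable[OF G_sums] p_nonneg
  by (intro suminf_nonneg) (auto simp: G_def)

lemma G_complement: "G M y + G (Mp - M) y = 1"
proof -
  have "(\<lambda>m. p (Suc m) * indicator M (atom (Suc m) y) + p (Suc m) * indicator (Mp - M) (atom (Suc m) y))
      = (\<lambda>m. p (Suc m))"
    using atom_in_Mp by (auto simp: indicator_def simp del: of_nat_Suc)
  then show ?thesis
    using sums_unique2[OF _ p_sums] sums_add[OF G_sums[of M y] G_sums[of "Mp - M" y]] by simp
qed

lemma K_eq_G: "K p y M = ennreal (G M y)"
proof -
  have "K p y M = (\<Sum>m. ennreal (p (Suc m) * indicator M (atom (Suc m) y)))"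
    unfolding K_def by (intro suminf_cong) (simp add: indicator_def)
  also have "\<dots> = ennreal (G M y)"
    using sums_summable[OF G_sums] p_nonneg unfolding G_def by (intro suminf_ennreal2) auto
  finally show ?thesis .
qed

text \<open>Here \<open>i n\<close> indexes the block around a fixed point y. This is assumed only
  eventually, since for small n the blocks need not reach y.\<close>

context
  fixes i :: "nat \<Rightarrow> nat" and y :: real
  assumes y: "y \<in> E"
    and i: "\<forall>\<^sub>F n in sequentially. 1 \<le> i n \<and> i n \<le> k n
      \<and> real ((i n - 1) * (n div k n)) / real n < y \<and> y \<le> real (i n * (n div k n)) / real n"
begin

abbreviation D :: "nat \<Rightarrow> 'a \<Rightarrow> nat set" where
  "D n \<equiv> exceed \<xi> u n (block k n (i n))"

abbreviation N :: "nat \<Rightarrow> 'a \<Rightarrow> real measure" where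
  "N n \<equiv> exceed_process \<xi> u n (block k n (i n))"

lemma eventually_points_near:
  assumes "\<eta> > 0"
  shows "\<forall>\<^sub>F n in sequentially. 1 \<le> i n \<and> i n \<le> k n \<and> (\<forall>j\<in>block k n (i n). \<bar>real j / real n - y\<bar> < \<eta>)"
proof -
  have "\<forall>\<^sub>F n in sequentially. real (n div k n) / real n < \<eta>"
    using order_tendstoD(2)[OF block_width_tendsto_0[OF k_at_top] assms] .
  then show ?thesis using i
  proof eventually_elim
    case (elim n)
    have "\<bar>real j / real n - y\<bar> < \<eta>" if j: "j \<in> block k n (i n)" for j
    proof -
      let ?r = "n div k n"
      have "i n * ?r = (i n - 1) * ?r + ?r"
        using elim(2) by (cases "i n") auto
      then have eq: "real (i n * ?r) / real n = real ((i n - 1) * ?r) / real n + real ?r / real n"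
        by (simp only: of_nat_add add_divide_distrib)
      have "real ((i n - 1) * ?r) / real n \<le> real j / real n"
        using j by (intro divide_right_mono) (simp_all add: block_def del: of_nat_mult)
      moreover have "real j / real n \<le> real (i n * ?r) / real n"
        using j by (intro divide_right_mono) (simp_all add: block_def del: of_nat_mult)
      ultimately show ?thesis using elim eq by linarith
    qed
    then show ?case using elim(2) by blast
  qed
qed

text \<open>The whole block is eventually within the radius given by
  \<open>dirac_sum_vague_nhd\<close>, wherever its exceedances fall; hence the quantifier over
  \<omega> stands inside the eventuality.\<close>

lemma eventually_process_in_open:
  assumes V: "openin vague_topology V" "atom m y \<in> V"
  shows "\<forall>\<^sub>F n in sequentially. \<forall>\<omega>. card (D n \<omega>) = m \<longrightarrow> N n \<omega> \<in> V"
proof -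
  obtain \<eta> where \<eta>: "\<eta> > 0" "\<And>(S::nat set) z. finite S \<Longrightarrow> card S = m \<Longrightarrow> z ` S \<subseteq> E \<Longrightarrow>
      (\<And>j. j \<in> S \<Longrightarrow> \<bar>z j - y\<bar> < \<eta>) \<Longrightarrow> dirac_sum S z \<in> V"
    using dirac_sum_vague_nhd[OF V(1) y V(2)] by auto
  show ?thesis
    using eventually_points_near[OF \<eta>(1)]
  proof eventually_elim
    case (elim n)
    show ?case
    proof (intro allI impI)
      fix \<omega> assume "card (D n \<omega>) = m"
      then show "N n \<omega> \<in> V"
        unfolding exceed_process_def
      proof (rule \<eta>(2)[rotated])
        show "(\<lambda>j. real j / real n) ` D n \<omega> \<subseteq> E"
        proof (rule image_subsetI)
          fix j assume "j \<in> D n \<omega>"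
          then have "j \<in> {1..n}"
            using exceed_subset[of \<xi> u n "block k n (i n)" \<omega>] block_subset[of "i n" k n] elim by auto
          then show "real j / real n \<in> E" by (simp add: E_def)
        qed
        show "\<bar>real j / real n - y\<bar> < \<eta>" if "j \<in> D n \<omega>" for j
          using that elim exceed_subset[of \<xi> u n "block k n (i n)" \<omega>] by auto
      qed (simp add: finite_exceed)
    qed
  qed
qed

lemma size_prob_lim:
  assumes "m \<ge> 1"
  shows "(\<lambda>n. real (k n) * \<P>(\<omega> in P. card (D n \<omega>) = m)) \<longlonglongrightarrow> a * p m"
proof (rule Lim_transform_eventually[OF cluster_size_prob_lim[OF assms]])
  show "\<forall>\<^sub>F n in sequentially. real (k n) * \<P>(\<omega> in P. card (exceed \<xi> u n (block k n 1) \<omega>) = m) =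
      real (k n) * \<P>(\<omega> in P. card (D n \<omega>) = m)"
    using i
  proof eventually_elim
    case (elim n)
    then show ?case using prob_exceed_block[of "i n" "\<lambda>c. c = m" n k] by simp
  qed
qed

lemma sets_D: "{\<omega> \<in> space P. Q (D n \<omega>)} \<in> events"
  by (rule sets_exceed) (simp_all add: zero_notin_block)

lemma sets_DN: "{\<omega> \<in> space P. Q (D n \<omega>) (N n \<omega>)} \<in> events"
  unfolding exceed_process_def
  using sets_D[where Q = "\<lambda>S. Q S (dirac_sum S (\<lambda>j. real j / real n))" for n] .

lemma size_process_prob_lim:
  assumes M: "M \<subseteq> Mp" and reg: "p (Suc m) > 0 \<longrightarrow> atom (Suc m) y \<notin> vague_topology frontier_of M"
  shows "(\<lambda>n. real (k n) * \<P>(\<omega> in P. card (D n \<omega>) = Suc m \<and> N n \<omega> \<in> M))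
    \<longlonglongrightarrow> a * (p (Suc m) * indicator M (atom (Suc m) y))"
proof -
  have lim: "(\<lambda>n. real (k n) * \<P>(\<omega> in P. card (D n \<omega>) = Suc m)) \<longlonglongrightarrow> a * p (Suc m)"
    by (rule size_prob_lim) simp
  \<comment> \<open>If the size has limiting weight 0, the atom may lie on the boundary, but the
    bound by the size probability gives limit 0. Otherwise the atom is interior or exterior to
    \<open>M\<close>, and a block with this many exceedances eventually has its process surely
    inside or surely outside \<open>M\<close>.\<close>
  consider "p (Suc m) = 0" | "atom (Suc m) y \<in> M" "atom (Suc m) y \<notin> vague_topology frontier_of M"
    | "atom (Suc m) y \<notin> M" "atom (Suc m) y \<notin> vague_topology frontier_of M"
    using reg p_nonneg[of "Suc m"] by (cases "p (Suc m) = 0") auto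
  then show ?thesis
  proof cases
    case 1
    have "\<P>(\<omega> in P. card (D n \<omega>) = Suc m \<and> N n \<omega> \<in> M) \<le> \<P>(\<omega> in P. card (D n \<omega>) = Suc m)" for n
      by (intro finite_measure_mono sets_D) auto
    then have "\<forall>\<^sub>F n in sequentially. norm (real (k n) * \<P>(\<omega> in P. card (D n \<omega>) = Suc m \<and> N n \<omega> \<in> M))
        \<le> real (k n) * \<P>(\<omega> in P. card (D n \<omega>) = Suc m)"
      by (intro always_eventually allI) (simp add: mult_left_mono)
    moreover have "(\<lambda>n. real (k n) * \<P>(\<omega> in P. card (D n \<omega>) = Suc m)) \<longlonglongrightarrow> 0"
      using lim 1 by simp
    ultimately have "(\<lambda>n. real (k n) * \<P>(\<omega> in P. card (D n \<omega>) = Suc m \<and> N n \<omega> \<in> M)) \<longlonglongrightarrow> 0"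
      by (rule Lim_null_comparison)
    then show ?thesis using 1 by simp
  next
    case 2
    then have "atom (Suc m) y \<in> vague_topology interior_of M"
      using closure_of_subset[of M vague_topology] M by (auto simp: frontier_of_def)
    from eventually_process_in_open[OF openin_interior_of this]
    have "\<forall>\<^sub>F n in sequentially. real (k n) * \<P>(\<omega> in P. card (D n \<omega>) = Suc m) =
        real (k n) * \<P>(\<omega> in P. card (D n \<omega>) = Suc m \<and> N n \<omega> \<in> M)"
    proof eventually_elim
      case (elim n)
      then have "(card (D n \<omega>) = Suc m) = (card (D n \<omega>) = Suc m \<and> N n \<omega> \<in> M)" for \<omega>
        using interior_of_subset[of vague_topology M] by blast
      then show ?case by simp
    qed
    then show ?thesis using 2 Lim_transform_eventually[OF lim] by simp
  next
    case 3
    have "openin vague_topology (Mp - vague_topology closure_of M)"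
      using closedin_closure_of[of vague_topology M] by (simp add: closedin_def)
    moreover have "atom (Suc m) y \<in> Mp - vague_topology closure_of M"
      using 3 atom_in_Mp interior_of_subset[of vague_topology M] by (auto simp: frontier_of_def simp del: of_nat_Suc)
    ultimately have "\<forall>\<^sub>F n in sequentially. \<forall>\<omega>. card (D n \<omega>) = Suc m \<longrightarrow>
        N n \<omega> \<in> Mp - vague_topology closure_of M"
      by (rule eventually_process_in_open)
    then have "\<forall>\<^sub>F n in sequentially. 0 =
        real (k n) * \<P>(\<omega> in P. card (D n \<omega>) = Suc m \<and> N n \<omega> \<in> M)"
    proof eventually_elim
      case (elim n)
      then have "\<not> (card (D n \<omega>) = Suc m \<and> N n \<omega> \<in> M)" for \<omega>
        using closure_of_subset[of M vague_topology] M by auto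
      then have "{\<omega> \<in> space P. card (D n \<omega>) = Suc m \<and> N n \<omega> \<in> M} = {}" by blast
      then show ?case by (simp only: measure_empty mult_zero_right)
    qed
    then have "(\<lambda>n. real (k n) * \<P>(\<omega> in P. card (D n \<omega>) = Suc m \<and> N n \<omega> \<in> M)) \<longlonglongrightarrow> 0"
      by (rule Lim_transform_eventually[OF tendsto_const])
    then show ?thesis using 3 by simp
  qed
qed

lemma sum_size_process_prob_le:
  "(\<Sum>m<L. real (k n) * \<P>(\<omega> in P. card (D n \<omega>) = Suc m \<and> N n \<omega> \<in> M))
    \<le> real (k n) * \<P>(\<omega> in P. D n \<omega> \<noteq> {} \<and> N n \<omega> \<in> M)"
proof -
  let ?A = "\<lambda>m. {\<omega> \<in> space P. card (D n \<omega>) = Suc m \<and> N n \<omega> \<in> M}"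
  have A: "?A m \<in> events" for m
    using sets_DN[of "\<lambda>S \<mu>. card S = Suc m \<and> \<mu> \<in> M" n] .
  have "(\<Sum>m<L. prob (?A m)) = prob (\<Union>m<L. ?A m)"
  proof (rule finite_measure_finite_Union[symmetric])
    show "?A ` {..<L} \<subseteq> events" using A by blast
    show "disjoint_family_on ?A {..<L}" unfolding disjoint_family_on_def by auto
  qed simp
  also have "\<dots> \<le> \<P>(\<omega> in P. D n \<omega> \<noteq> {} \<and> N n \<omega> \<in> M)"
    by (intro finite_measure_mono sets_DN) auto
  finally show ?thesis
    by (simp only: sum_distrib_left[symmetric] mult_left_mono of_nat_0_le_iff)
qed

lemma process_prob_lim:
  assumes M: "M \<subseteq> Mp"
    and reg: "\<And>m. p (Suc m) > 0 \<Longrightarrow> atom (Suc m) y \<notin> vague_topology frontier_of M"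
  shows "(\<lambda>n. real (k n) * \<P>(\<omega> in P. D n \<omega> \<noteq> {} \<and> N n \<omega> \<in> M)) \<longlonglongrightarrow> a * G M y"
proof (rule tendsto_of_minorants)
  show "(\<lambda>n. real (k n) * \<P>(\<omega> in P. card (D n \<omega>) = Suc m \<and> N n \<omega> \<in> M))
    \<longlonglongrightarrow> a * (p (Suc m) * indicator M (atom (Suc m) y))" for m
    using reg by (intro size_process_prob_lim M) auto
  \<comment> \<open>A set and its complement share their boundary, so the same regularity serves
    both families of minorants.\<close>
  have "vague_topology frontier_of (Mp - M) = vague_topology frontier_of M"
    using frontier_of_complement[of vague_topology M] by simp
  then show "(\<lambda>n. real (k n) * \<P>(\<omega> in P. card (D n \<omega>) = Suc m \<and> N n \<omega> \<in> Mp - M))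
    \<longlonglongrightarrow> a * (p (Suc m) * indicator (Mp - M) (atom (Suc m) y))" for m
    using reg by (intro size_process_prob_lim) auto
  show "(\<lambda>m. a * (p (Suc m) * indicator M (atom (Suc m) y))) sums (a * G M y)" for M
    by (intro sums_mult G_sums)
  then show "(\<lambda>m. a * (p (Suc m) * indicator (Mp - M) (atom (Suc m) y))) sums (a * G (Mp - M) y)" .
  have "a * G M y + a * G (Mp - M) y = a"
    using G_complement[of M y] by (simp flip: distrib_left)
  moreover have "(\<lambda>n. real (k n) * \<P>(\<omega> in P. D n \<omega> \<noteq> {} \<and> N n \<omega> \<in> M)
      + real (k n) * \<P>(\<omega> in P. D n \<omega> \<noteq> {} \<and> N n \<omega> \<in> Mp - M)) \<longlonglongrightarrow> a"
  proof (rule Lim_transform_eventually[OF k_q_lim])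
    show "\<forall>\<^sub>F n in sequentially. real (k n) * q n = real (k n) * \<P>(\<omega> in P. D n \<omega> \<noteq> {} \<and> N n \<omega> \<in> M)
      + real (k n) * \<P>(\<omega> in P. D n \<omega> \<noteq> {} \<and> N n \<omega> \<in> Mp - M)"
      using i
    proof eventually_elim
      case (elim n)
      let ?A = "\<lambda>M. {\<omega> \<in> space P. D n \<omega> \<noteq> {} \<and> N n \<omega> \<in> M}"
      have "{\<omega> \<in> space P. D n \<omega> \<noteq> {}} = ?A M \<union> ?A (Mp - M)"
        using exceed_process_in_Mp[OF finite_block] by auto
      moreover have "prob (?A M \<union> ?A (Mp - M)) = prob (?A M) + prob (?A (Mp - M))"
        by (intro finite_measure_Union sets_DN) auto
      ultimately have "q n = prob (?A M) + prob (?A (Mp - M))"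
        using elim prob_exceed_block_nonempty[of "i n" n k] by (simp add: q_def)
      then show ?case by (simp only: distrib_left)
    qed
  qed
  ultimately show "(\<lambda>n. real (k n) * \<P>(\<omega> in P. D n \<omega> \<noteq> {} \<and> N n \<omega> \<in> M)
      + real (k n) * \<P>(\<omega> in P. D n \<omega> \<noteq> {} \<and> N n \<omega> \<in> Mp - M)) \<longlonglongrightarrow> a * G M y + a * G (Mp - M) y"
    by simp
qed (rule sum_size_process_prob_le)+

text \<open>As y differs from x, the shrinking block eventually lies on one side of x: the event of
  a last exceedance beyond x becomes either the presence of any exceedance or impossible.\<close>

lemma block_prob_lim:
  assumes M: "M \<subseteq> Mp" and x: "x > 0" "y \<noteq> x"
    and reg: "\<And>m. y > x \<Longrightarrow> p (Suc m) > 0 \<Longrightarrow> atom (Suc m) y \<notin> vague_topology frontier_of M"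
  shows "(\<lambda>n. real (k n) * \<P>(\<omega> in P. last_exceed \<xi> u n (block k n (i n)) \<omega> > x \<and> N n \<omega> \<in> M))
    \<longlonglongrightarrow> a * G M y * indicator {x<..} y"
proof (cases "y > x")
  case True
  then have "y - x > 0" by simp
  from eventually_points_near[OF this]
  have "\<forall>\<^sub>F n in sequentially. real (k n) * \<P>(\<omega> in P. D n \<omega> \<noteq> {} \<and> N n \<omega> \<in> M)
      = real (k n) * \<P>(\<omega> in P. last_exceed \<xi> u n (block k n (i n)) \<omega> > x \<and> N n \<omega> \<in> M)"
  proof eventually_elim
    case (elim n)
    have "last_exceed \<xi> u n (block k n (i n)) \<omega> > x \<longleftrightarrow> D n \<omega> \<noteq> {}" for \<omega>
    proof -
      have "real j / real n > x" if "j \<in> D n \<omega>" for j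
        using elim that exceed_subset[of \<xi> u n "block k n (i n)" \<omega>] by force
      then show ?thesis by (auto simp: last_exceed_gt_iff[OF finite_block x(1)])
    qed
    then show ?case by simp
  qed
  then show ?thesis
    using True Lim_transform_eventually[OF process_prob_lim[OF M]] reg by simp
next
  case False
  then have "x - y > 0" using x by simp
  from eventually_points_near[OF this]
  have "\<forall>\<^sub>F n in sequentially. 0
      = real (k n) * \<P>(\<omega> in P. last_exceed \<xi> u n (block k n (i n)) \<omega> > x \<and> N n \<omega> \<in> M)"
  proof eventually_elim
    case (elim n)
    have "\<not> last_exceed \<xi> u n (block k n (i n)) \<omega> > x" for \<omega>
    proof -
      have "\<not> real j / real n > x" if "j \<in> D n \<omega>" for j
        using elim that exceed_subset[of \<xi> u n "block k n (i n)" \<omega>] by force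
      then show ?thesis by (auto simp: last_exceed_gt_iff[OF finite_block x(1)])
    qed
    then show ?case by simp
  qed
  then have "(\<lambda>n. real (k n) * \<P>(\<omega> in P. last_exceed \<xi> u n (block k n (i n)) \<omega> > x \<and> N n \<omega> \<in> M))
    \<longlonglongrightarrow> 0"
    by (rule Lim_transform_eventually[OF tendsto_const])
  then show ?thesis using False by simp
qed

end

end

section \<open>Passage to the limit\<close>

lemma sets_Mp_subset: "M \<in> sets_Mp \<Longrightarrow> M \<subseteq> Mp"
proof -
  have "{U. openin vague_topology U} \<subseteq> Pow Mp"
    using openin_subset[of vague_topology] by auto
  then show "M \<in> sets_Mp \<Longrightarrow> M \<subseteq> Mp"
    unfolding sets_Mp_def using sigma_sets_into_sp by blast
qed

section \<open>Step functions on the block intervals\<close>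

abbreviation block_interval :: "(nat \<Rightarrow> nat) \<Rightarrow> nat \<Rightarrow> nat \<Rightarrow> real set" where
  "block_interval k n i \<equiv> {real ((i - 1) * (n div k n)) / real n<..real (i * (n div k n)) / real n}"

lemma block_interval_disjoint:
  assumes "y \<in> block_interval k n i" "y \<in> block_interval k n j"
  shows "i = j"
proof (rule ccontr)
  have *: "\<not> i < j" if "y \<in> block_interval k n i" "y \<in> block_interval k n j" for i j
  proof
    assume "i < j"
    then have "i * (n div k n) \<le> (j - 1) * (n div k n)" by (intro mult_le_mono1) auto
    then have "real (i * (n div k n)) / real n \<le> real ((j - 1) * (n div k n)) / real n"
      by (intro divide_right_mono) (simp_all only: of_nat_le_iff of_nat_0_le_iff)
    then show False using that by (simp del: of_nat_mult)
  qed
  assume "i \<noteq> j"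
  then show False using *[of i j] *[of j i] assms by linarith
qed

lemma block_interval_subset_E:
  assumes "1 \<le> i" "i \<le> k n"
  shows "block_interval k n i \<subseteq> E"
proof -
  have "i * (n div k n) \<le> n"
    using mult_le_mono1[OF assms(2), of "n div k n"] times_div_less_eq_dividend[of "k n" n]
    by (rule order_trans)
  then have "real (i * (n div k n)) / real n \<le> 1"
    by (cases "n = 0") (simp_all add: divide_le_eq flip: of_nat_mult)
  moreover have "0 \<le> real ((i - 1) * (n div k n)) / real n" by simp
  ultimately show ?thesis unfolding E_def by (intro subsetI) (simp only: greaterThanAtMost_iff, linarith)
qed

lemma ex_block_interval:
  assumes "n div k n \<ge> 1" "0 < y" "y < real (k n * (n div k n)) / real n"
  shows "\<exists>i. 1 \<le> i \<and> i \<le> k n \<and> y \<in> block_interval k n i"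
proof -
  let ?r = "n div k n"
  have r: "real ?r > 0" using assms(1) by simp
  have n: "real n > 0" using assms(1) by (auto intro: gr0I)
  define t where "t = y * real n / real ?r"
  have t: "t > 0" using r n assms(2) by (simp add: t_def)
  \<comment> \<open>In units of the block width y sits at t; rounding up matches intervals open on
    the left.\<close>
  define i where "i = nat \<lceil>t\<rceil>"
  have i: "real i - 1 < t" "t \<le> real i" using t unfolding i_def by linarith+
  have y: "y = t * real ?r / real n" using r n by (simp add: t_def)
  have "t < real (k n)" using assms(3) r n unfolding y by (simp add: field_simps)
  then have "i \<le> k n" using i by linarith
  moreover have "i \<ge> 1" using i t by linarith
  moreover have "y \<in> block_interval k n i"
    using i r n \<open>i \<ge> 1\<close> unfolding y
    by (simp add: of_nat_diff divide_strict_right_mono divide_right_mono)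
  ultimately show ?thesis by blast
qed

context exceedance_clusters
begin

definition w :: "real \<Rightarrow> real measure set \<Rightarrow> nat \<Rightarrow> nat \<Rightarrow> real" where
  "w x M n i = \<P>(\<omega> in P. last_exceed \<xi> u n (block k n i) \<omega> > x \<and> exceed_process \<xi> u n (block k n i) \<omega> \<in> M)"

text \<open>The step function whose integral is the sum over the blocks.\<close>

definition F :: "real \<Rightarrow> real measure set \<Rightarrow> nat \<Rightarrow> real \<Rightarrow> real" where
  "F x M n y = (\<Sum>i\<in>{1..k n}. real n / real (n div k n) * w x M n i * indicator (block_interval k n i) y)"

lemma w_nonneg: "0 \<le> w x M n i"
  by (simp add: w_def)

lemma w_le_q:
  assumes "i \<ge> 1" "x > 0"
  shows "w x M n i \<le> q n"
proof -
  have "w x M n i \<le> \<P>(\<omega> in P. exceed \<xi> u n (block k n i) \<omega> \<noteq> {})"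
    unfolding w_def using assms(2)
    by (intro finite_measure_mono sets_exceed) (auto simp: zero_notin_block last_exceed_def)
  then show ?thesis using prob_exceed_block_nonempty[OF assms(1), of n k] by (simp add: q_def)
qed

lemma F_eq:
  assumes "1 \<le> i" "i \<le> k n" "y \<in> block_interval k n i"
  shows "F x M n y = real n / real (n div k n) * w x M n i"
proof -
  have "F x M n y = (\<Sum>j\<in>{1..k n}. if i = j then real n / real (n div k n) * w x M n j else 0)"
    unfolding F_def
  proof (rule sum.cong)
    fix j
    have "y \<in> block_interval k n j \<longleftrightarrow> i = j"
      using assms(3) block_interval_disjoint[of y i n k j] by blast
    then show "real n / real (n div k n) * w x M n j * indicator (block_interval k n j) y =
        (if i = j then real n / real (n div k n) * w x M n j else 0)"
      by (simp add: indicator_def del: greaterThanAtMost_iff)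
  qed simp
  then show ?thesis using assms by simp
qed

text \<open>The height n / r_n is at most twice \<open>k n\<close> by
  \<open>le_2_k_block_length\<close>, and \<open>w\<close> is at most \<open>q n\<close>, so a bound
  on \<open>k n * q n\<close> dominates \<open>F\<close> on \<open>E\<close>; off the blocks
  \<open>F\<close> vanishes.\<close>

lemma F_le:
  assumes "x > 0" "n div k n \<ge> 1" "real (k n) * q n \<le> c"
  shows "F x M n y \<le> 2 * c * indicator E y"
proof (cases "\<exists>i. 1 \<le> i \<and> i \<le> k n \<and> y \<in> block_interval k n i")
  case True
  then obtain i where i: "1 \<le> i" "i \<le> k n" "y \<in> block_interval k n i" by blast
  have "real n \<le> 2 * real (k n) * real (n div k n)"
    using le_2_k_block_length[OF assms(2)] by (metis of_nat_le_iff of_nat_mult of_nat_numeral)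
  then have "real n / real (n div k n) \<le> 2 * real (k n)"
    using assms(2) by (simp add: divide_le_eq)
  then have "F x M n y \<le> 2 * real (k n) * q n"
    unfolding F_eq[OF i] using w_le_q[OF i(1) assms(1)] w_nonneg by (intro mult_mono) auto
  moreover have "y \<in> E" using i block_interval_subset_E by blast
  ultimately show ?thesis using assms(3) by simp
next
  case False
  then have "F x M n y = 0"
    unfolding F_def by (intro sum.neutral) (auto simp: indicator_def simp del: greaterThanAtMost_iff)
  moreover have "c \<ge> 0" using assms(3) q_nonneg[of n] by (meson mult_nonneg_nonneg of_nat_0_le_iff order_trans)
  ultimately show ?thesis by (simp add: indicator_def)
qed

text \<open>The factor n / r_n in \<open>F\<close> is the reciprocal of the length of a block
  interval and cancels on integration.\<close>

lemma nn_integral_F: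
  assumes "n div k n \<ge> 1"
  shows "(\<integral>\<^sup>+y. ennreal (F x M n y) \<partial>lborel) = ennreal (\<Sum>i\<in>{1..k n}. w x M n i)"
proof -
  let ?c = "real n / real (n div k n)"
  have n: "n > 0" using assms by (auto intro: gr0I)
  have "ennreal (F x M n y) = (\<Sum>i\<in>{1..k n}. ennreal (?c * w x M n i) * indicator (block_interval k n i) y)" for y
  proof -
    have "ennreal (F x M n y) = (\<Sum>i\<in>{1..k n}. ennreal (?c * w x M n i * indicator (block_interval k n i) y))"
      unfolding F_def using w_nonneg by (subst sum_ennreal) (auto simp: indicator_def)
    also have "\<dots> = (\<Sum>i\<in>{1..k n}. ennreal (?c * w x M n i) * indicator (block_interval k n i) y)"
      by (intro sum.cong) (auto simp: indicator_def)
    finally show ?thesis .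
  qed
  then have "(\<integral>\<^sup>+y. ennreal (F x M n y) \<partial>lborel)
      = (\<integral>\<^sup>+y. (\<Sum>i\<in>{1..k n}. ennreal (?c * w x M n i) * indicator (block_interval k n i) y) \<partial>lborel)"
    by (simp only:)
  also have "\<dots> = (\<Sum>i\<in>{1..k n}. \<integral>\<^sup>+y. ennreal (?c * w x M n i) * indicator (block_interval k n i) y \<partial>lborel)"
    by (rule nn_integral_sum) measurable
  also have "\<dots> = (\<Sum>i\<in>{1..k n}. ennreal (?c * w x M n i) * emeasure lborel (block_interval k n i))"
    by (intro sum.cong refl nn_integral_cmult_indicator) simp
  also have "\<dots> = (\<Sum>i\<in>{1..k n}. ennreal (w x M n i))"
  proof (rule sum.cong)
    fix i assume "i \<in> {1..k n}"
    then have "i * (n div k n) = (i - 1) * (n div k n) + n div k n" by (cases i) auto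
    then have eq: "real (i * (n div k n)) / real n
        = real ((i - 1) * (n div k n)) / real n + real (n div k n) / real n"
      by (simp only: of_nat_add add_divide_distrib)
    have "emeasure lborel (block_interval k n i) = ennreal (real (n div k n) / real n)"
      unfolding eq by (subst emeasure_lborel_Ioc) auto
    then show "ennreal (?c * w x M n i) * emeasure lborel (block_interval k n i) = ennreal (w x M n i)"
      using assms n w_nonneg by (simp add: ennreal_mult[symmetric])
  qed simp
  also have "\<dots> = ennreal (\<Sum>i\<in>{1..k n}. w x M n i)"
    using w_nonneg by (intro sum_ennreal) auto
  finally show ?thesis .
qed

lemma F_lim:
  assumes M: "M \<subseteq> Mp" and x: "x > 0" and y: "0 < y" "y < 1" "y \<noteq> x"
    and reg: "\<And>m. y > x \<Longrightarrow> p (Suc m) > 0 \<Longrightarrow> atom (Suc m) y \<notin> vague_topology frontier_of M"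
  shows "(\<lambda>n. F x M n y) \<longlonglongrightarrow> a * G M y * indicator {x<..} y"
proof -
  have yE: "y \<in> E" using y by (simp add: E_def)
  define i where "i n = (SOME i. 1 \<le> i \<and> i \<le> k n \<and> y \<in> block_interval k n i)" for n
  have i: "\<forall>\<^sub>F n in sequentially. 1 \<le> i n \<and> i n \<le> k n \<and> y \<in> block_interval k n (i n)"
    using order_tendstoD(1)[OF blocks_length_lim y(2)] eventually_block_length
  proof eventually_elim
    case (elim n)
    then have "\<exists>i. 1 \<le> i \<and> i \<le> k n \<and> y \<in> block_interval k n i"
      using y(1) by (intro ex_block_interval)
    then show ?case unfolding i_def by (rule someI_ex)
  qed
  then have "\<forall>\<^sub>F n in sequentially. 1 \<le> i n \<and> i n \<le> k n
      \<and> real ((i n - 1) * (n div k n)) / real n < y \<and> y \<le> real (i n * (n div k n)) / real n"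
    by simp
  from block_prob_lim[OF yE this M x y(3) reg]
  have "(\<lambda>n. real (k n) * w x M n (i n)) \<longlonglongrightarrow> a * G M y * indicator {x<..} y"
    by (simp add: w_def)
  \<comment> \<open>The height n / r_n is rewritten as \<open>k n\<close> times n / (k_n r_n);
    exhaustion sends the second factor to 1.\<close>
  from tendsto_mult[OF tendsto_inverse[OF blocks_length_lim] this]
  have "(\<lambda>n. inverse (real (k n * (n div k n)) / real n) * (real (k n) * w x M n (i n)))
      \<longlonglongrightarrow> a * G M y * indicator {x<..} y" by simp
  then show ?thesis
  proof (rule Lim_transform_eventually)
    show "\<forall>\<^sub>F n in sequentially. inverse (real (k n * (n div k n)) / real n) * (real (k n) * w x M n (i n)) = F x M n y"
      using i
    proof eventually_elim
      case (elim n)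
      then have "real (k n) \<noteq> 0" by auto
      have "F x M n y = real n / real (n div k n) * w x M n (i n)"
        using elim by (intro F_eq) auto
      then show ?case using \<open>real (k n) \<noteq> 0\<close> by (simp add: field_simps)
    qed
  qed
qed

text \<open>Stated for all of \<open>sets_Mp\<close> and not just \<open>sets_M0\<close>, so that it
  applies to \<open>Mp\<close> itself, which contains the null measure and yields part (a).\<close>

lemma sum_block_prob_lim:
  assumes x: "x > 0" and M: "M \<in> sets_Mp"
    and reg: "lam a p ((vague_topology frontier_of M) \<inter> M_gt x) = 0"
  shows "(\<lambda>n. ennreal (\<Sum>i\<in>{1..k n}. w x M n i)) \<longlonglongrightarrow> lam a p (M \<inter> M_gt x)"
proof -
  have [measurable]: "E \<in> sets borel" by (simp add: E_def)
  note borel_measurable_K[OF M, measurable]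
  let ?g = "\<lambda>y. ennreal a * (K p y M * indicator {x<..} y) * indicator E y"
  have lam: "lam a p (M \<inter> M_gt x) = (\<integral>\<^sup>+y. ?g y \<partial>lborel)"
    unfolding lam_Int_M_gt[OF x] using a_pos by (intro nn_integral_nu) auto
  have "\<forall>\<^sub>F n in sequentially. real (k n) * q n \<le> a + 1"
    using order_tendstoD(2)[OF k_q_lim, of "a + 1"] by (auto elim: eventually_mono)
  then have "\<forall>\<^sub>F n in sequentially. n div k n \<ge> 1 \<and> real (k n) * q n \<le> a + 1"
    using eventually_block_length by eventually_elim auto
  \<comment> \<open>The domination holds only from some index on, so dominated convergence is
    applied to the shifted sequence.\<close>
  then obtain n0 where n0: "\<And>n. n \<ge> n0 \<Longrightarrow> n div k n \<ge> 1 \<and> real (k n) * q n \<le> a + 1"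
    by (auto simp: eventually_sequentially)
  have "(\<lambda>n. \<integral>\<^sup>+y. ennreal (F x M (n + n0) y) \<partial>lborel) \<longlonglongrightarrow> (\<integral>\<^sup>+y. ?g y \<partial>lborel)"
  proof (rule nn_integral_dominated_convergence)
    show "(\<lambda>y. ennreal (F x M (n + n0) y)) \<in> borel_measurable lborel" for n
      unfolding F_def by measurable
    show "?g \<in> borel_measurable lborel" by measurable
    show "(\<lambda>y. ennreal (2 * (a + 1)) * indicator E y) \<in> borel_measurable lborel" by measurable
    show "(\<integral>\<^sup>+y. ennreal (2 * (a + 1)) * indicator E y \<partial>lborel) < \<infinity>"
      by (simp add: nn_integral_cmult_indicator) (simp add: E_def ennreal_mult_less_top)
    show "AE y in lborel. ennreal (F x M (n + n0) y) \<le> ennreal (2 * (a + 1)) * indicator E y" for n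
    proof (rule AE_I2)
      fix y
      have "F x M (n + n0) y \<le> 2 * (a + 1) * indicator E y"
        using n0[of "n + n0"] by (intro F_le x) auto
      then show "ennreal (F x M (n + n0) y) \<le> ennreal (2 * (a + 1)) * indicator E y"
        using ennreal_leI[of "F x M (n + n0) y" "2 * (a + 1) * indicator E y"]
        by (cases "y \<in> E") auto
    qed
    show "AE y in lborel. (\<lambda>n. ennreal (F x M (n + n0) y)) \<longlonglongrightarrow> ?g y"
      \<comment> \<open>Two further points are discarded: x, where the limit may jump, and 1, which
        the blocks may never reach.\<close>
      using AE_atom_notin_frontier[OF x a_pos reg] AE_lborel_singleton[of x] AE_lborel_singleton[of 1]
    proof eventually_elim
      case (elim y)
      show ?case
      proof (cases "y \<in> E")
        case True
        then have y: "0 < y" "y < 1" using elim by (auto simp: E_def)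
        have "(\<lambda>n. F x M (n + n0) y) \<longlonglongrightarrow> a * G M y * indicator {x<..} y"
          using True elim by (intro LIMSEQ_ignore_initial_segment F_lim sets_Mp_subset M x y) auto
        then have "(\<lambda>n. ennreal (F x M (n + n0) y)) \<longlonglongrightarrow> ennreal (a * G M y * indicator {x<..} y)"
          by (rule tendsto_ennrealI)
        also have "ennreal (a * G M y * indicator {x<..} y) = ?g y"
          using True a_pos G_nonneg[of M y] by (auto simp: K_eq_G indicator_def ennreal_mult)
        finally show ?thesis .
      next
        case False
        have "F x M (n + n0) y \<le> 0" for n
          using F_le[of x "n + n0" "a + 1" M y] n0[of "n + n0"] x False by simp
        then show ?thesis using False by (simp add: ennreal_neg)
      qed
    qed
  qed
  moreover have "(\<integral>\<^sup>+y. ennreal (F x M (n + n0) y) \<partial>lborel) = ennreal (\<Sum>i\<in>{1..k (n + n0)}. w x M (n + n0) i)" for n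
    using n0[of "n + n0"] by (intro nn_integral_F) auto
  ultimately show ?thesis
    unfolding lam by (simp add: LIMSEQ_offset[where k = n0])
qed

lemma sum_block_last_exceed_lim:
  assumes x: "x > 0"
  shows "(\<lambda>n. ennreal (\<Sum>i\<in>{1..k n}. \<P>(\<omega> in P. last_exceed \<xi> u n (block k n i) \<omega> > x)))
    \<longlonglongrightarrow> lam a p (M_gt x)"
proof -
  have "vague_topology frontier_of Mp = {}"
    using frontier_of_topspace[of vague_topology] by simp
  then have "lam a p ((vague_topology frontier_of Mp) \<inter> M_gt x) = 0"
    by (simp add: lam_def K_def)
  from sum_block_prob_lim[OF x Mp_in_sets_Mp this] show ?thesis
    using M_gt_subset_Mp[of x] by (simp add: w_def Int_absorb1 exceed_process_in_Mp)
qed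

end

theorem proposition3p1:
  fixes P :: "'a measure" and \<xi> :: "nat \<Rightarrow> 'a \<Rightarrow> real" and u :: "nat \<Rightarrow> real"
    and k :: "nat \<Rightarrow> nat" and a :: real and p :: "nat \<Rightarrow> real"
  assumes "prob_space P"
    and "\<And>j. j \<ge> 1 \<Longrightarrow> \<xi> j \<in> borel_measurable P"
    and "stationary_seq P \<xi>"
    and "(\<lambda>n. real n * \<P>(\<omega> in P. \<xi> 1 \<omega> > u n)) \<longlonglongrightarrow> 1"
    and "filterlim k at_top sequentially"
    and "\<And>B. B \<in> rel_compact_borel \<Longrightarrow>
      (\<lambda>n. MAX i\<in>{1..k n}. \<P>(\<omega> in P. emeasure (exceed_process \<xi> u n (block k n i) \<omega>) B > 0)) \<longlonglongrightarrow> 0"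
    and "\<And>f. f \<in> CK_plus \<Longrightarrow>
      (\<lambda>n. \<bar>(\<integral>\<omega>. exp (- (\<integral>y. f y \<partial>exceed_process \<xi> u n {1..n} \<omega>)) \<partial>P)
         - (\<Prod>i\<in>{1..k n}. \<integral>\<omega>. exp (- (\<integral>y. f y \<partial>exceed_process \<xi> u n (block k n i) \<omega>)) \<partial>P)\<bar>) \<longlonglongrightarrow> 0"
    and "a > 0"
    and "\<And>m. m \<ge> 1 \<Longrightarrow> p m \<ge> 0" and "(\<lambda>m. p (Suc m)) sums 1"
    and "(\<lambda>n. real (k n) * \<P>(\<omega> in P. (MAX j\<in>block k n 1. \<xi> j \<omega>) > u n)) \<longlonglongrightarrow> a"
    and "\<And>m. m \<ge> 1 \<Longrightarrow>
      (\<lambda>n. \<P>(\<omega> in P. (\<Sum>j\<in>block k n 1. if \<xi> j \<omega> > u n then 1 else 0) = m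
               \<bar> (MAX j\<in>block k n 1. \<xi> j \<omega>) > u n)) \<longlonglongrightarrow> p m"
  shows
    "(\<forall>x>0. (\<lambda>n. ennreal (\<Sum>i\<in>{1..k n}. \<P>(\<omega> in P. last_exceed \<xi> u n (block k n i) \<omega> > x)))
        \<longlonglongrightarrow> lam a p (M_gt x))
   \<and> (\<forall>x>0. lam a p (M_gt x) > 0 \<longrightarrow>
        (\<forall>M\<in>sets_M0. lam a p ((vague_topology frontier_of M) \<inter> M_gt x) = 0 \<longrightarrow>
          (\<lambda>n. ennreal (\<Sum>i\<in>{1..k n}. \<P>(\<omega> in P. last_exceed \<xi> u n (block k n i) \<omega> > x
                                 \<and> exceed_process \<xi> u n (block k n i) \<omega> \<in> M)))
            \<longlonglongrightarrow> lam a p (M \<inter> M_gt x)))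
   \<and> (\<forall>x>0. \<forall>M\<in>sets_Mp.
        lam a p (M_gt x) = emeasure (nu a) {x<..}
      \<and> lam a p (M \<inter> M_gt x) = (\<integral>\<^sup>+y. K p y M * indicator {x<..} y \<partial>nu a))"
proof -
  interpret prob_space P by (fact assms(1))
  interpret exceedance_clusters P \<xi> u k a p
    by unfold_locales (fact assms)+
  show ?thesis
  proof (intro conjI allI ballI impI)
    fix x :: real assume x: "x > 0"
    show "(\<lambda>n. ennreal (\<Sum>i\<in>{1..k n}. \<P>(\<omega> in P. last_exceed \<xi> u n (block k n i) \<omega> > x)))
        \<longlonglongrightarrow> lam a p (M_gt x)"
      by (rule sum_block_last_exceed_lim[OF x])
    show "lam a p (M_gt x) = emeasure (nu a) {x<..}"
      using assms(9,10) x by (rule lam_M_gt)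
    show "lam a p (M \<inter> M_gt x) = (\<integral>\<^sup>+y. K p y M * indicator {x<..} y \<partial>nu a)" for M
      by (rule lam_Int_M_gt[OF x])
    fix M assume "M \<in> sets_M0" and reg: "lam a p ((vague_topology frontier_of M) \<inter> M_gt x) = 0"
    then have "M \<in> sets_Mp" by (simp add: sets_M0_def)
    from sum_block_prob_lim[OF x this reg]
    show "(\<lambda>n. ennreal (\<Sum>i\<in>{1..k n}. \<P>(\<omega> in P. last_exceed \<xi> u n (block k n i) \<omega> > x
             \<and> exceed_process \<xi> u n (block k n i) \<omega> \<in> M))) \<longlonglongrightarrow> lam a p (M \<inter> M_gt x)"
      unfolding w_def .
  qed
qed

end
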